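(* Every oriented graph $G$ with $n$ vertices and $m$ arcs satisfies $$a(G) \ge \frac{7n - m - h}{9},$$ where $h = h(G)$ is the number of connected components of $G$ that belong to the family $\mathcal{H}$.
   Context: An oriented graph is a finite directed graph with no loops, no parallel arcs and no digons (no pair of opposite arcs between the same two vertices). A set of vertices of $G$ is acyclic if the subgraph it induces contains no directed cycle; $a(G)$ denotes the maximum size of an acyclic set of vertices of $G$. $P^7$ is the Paley graph of order 7: the oriented graph with vertex set $\mathbb{Z}/7\mathbb{Z}$ and arcs $i \to i+1$, $i\to i+2$, $i \to i+4$ for all $i$ (7 vertices, 21 arcs, every vertex of total degree 6). $\mathcal{H}$ is the smallest family of oriented graphs (up to isomorphism) that contains $P^7$ and contains every graph obtained from the disjoint union of two graphs of $\mathcal{H}$ by adding one arc (in either direction) between a vertex of one and a vertex of the other. Connected components are those of the underlying undirected graph, and $h(G)$ is the number of connected components of $G$ that are isomorphic to a graph of $\mathcal{H}$. *)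

theory Defs
  imports Complex_Main "Graph_Theory.Graph_Theory"
begin

locale oriented_graph = digraph +
  assumes no_digons: "u \<rightarrow>\<^bsub>G\<^esub> v \<Longrightarrow> \<not> v \<rightarrow>\<^bsub>G\<^esub> u"

definition acyclic_set :: "('a,'b) pre_digraph \<Rightarrow> 'a set \<Rightarrow> bool" where
  "acyclic_set G S \<longleftrightarrow> S \<subseteq> verts G \<and> \<not> (\<exists>p. pre_digraph.cycle (G \<restriction> S) p)"

definition max_acyclic :: "('a,'b) pre_digraph \<Rightarrow> nat" where
  "max_acyclic G = Max {card S |S. acyclic_set G S}"

definition paley7 :: "nat pair_pre_digraph" where
  "paley7 = \<lparr> pverts = {0..<7}, parcs = {(i, (i + d) mod 7) |i d. i < 7 \<and> d \<in> {1,2,4}} \<rparr>"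

text \<open>
  Every finite graph has an isomorphic copy on a set of natural numbers, so the family is
  represented by its members on subsets of \<^typ>\<open>nat\<close>. The rule \<open>iso\<close> makes the family closed
  under isomorphism; in particular it provides vertex-disjoint copies of any two members, so that
  \<open>join\<close> covers arbitrary disjoint unions.
\<close>

inductive paley_family :: "nat pair_pre_digraph \<Rightarrow> bool" where
  paley: "paley_family paley7"
| iso: "paley_family A \<Longrightarrow> digraph_iso (with_proj A) (with_proj B) \<Longrightarrow> paley_family B"
| join: "\<lbrakk>paley_family A; paley_family B; pverts A \<inter> pverts B = {};
    u \<in> pverts A; v \<in> pverts B; e = (u, v) \<or> e = (v, u)\<rbrakk>
    \<Longrightarrow> paley_family \<lparr> pverts = pverts A \<union> pverts B, parcs = insert e (parcs A \<union> parcs B) \<rparr>"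

text \<open>
  The constant \<^const>\<open>Digraph_Component.connected\<close> (not the topological notion of the same
  name) is connectedness of the underlying undirected graph, and excludes the empty graph.
\<close>

definition components :: "('a,'b) pre_digraph \<Rightarrow> ('a,'b) pre_digraph set" where
  "components G = {C. pre_digraph.max_subgraph G Digraph_Component.connected C}"

definition paley_components :: "('a,'b) pre_digraph \<Rightarrow> nat" where
  "paley_components G =
    card {C \<in> components G. \<exists>H. paley_family H \<and> digraph_iso C (with_proj H)}"

end

theory Submission
  imports Defs
begin

text \<open>
  Take a counterexample with the fewest vertices. If a nonempty set \<open>X\<close> of vertices contains a set
  \<open>S\<close> that no directed cycle of the graph without \<open>X - S\<close> meets, then an optimal acyclic set of the
  graph without \<open>X\<close> can be enlarged by \<open>S\<close>, so that \<open>9 |S| - 7 |X| + m(X)\<close> is negative up to the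
  change of \<open>h\<close>, where \<open>m(X)\<close> counts the arcs that meet \<open>X\<close>. Applied to an induced member of
  the family this gives at least four arcs in either direction that leave it; applied to a single
  vertex it then gives maximum degree 6, so that no induced member of the family is left at all.
  The same inequality excludes in- and out-degrees below 2 and the type (4,2), and contracting an
  arc \<open>v \<rightarrow> u\<close> with \<open>v\<close> of out-degree 2 shows that the arc lies in a directed triangle. The
  remaining vertices have in- and out-degree 2 or 3, and a finite case distinction around a vertex,
  driven by these two facts, shows first that no arc joins degrees 4 and 6, then that
  degree 5 does not occur, and finally that neither a 4-regular nor a 6-regular counterexample
  exists. The case distinctions are stored as decision trees, which a verified checker evaluates.
\<close>

section \<open>Acyclic sets and the Paley family on relations\<close>

text \<open>The term \<open>h\<close> is the obstacle. Deleting vertices can create components of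
  the family, so minimality alone gives an inequality with an uncontrolled gain on the right.
  Members of the family are also tight: one built from \<open>t\<close> copies of the Paley graph
  has 7t vertices and 22t - 1 arcs, so the claimed lower bound for it is exactly 3t. Hence no slack
  is available inside a member and its links to the rest have to be counted. The constant four comes
  from a robust form of the bound for members: an acyclic set of size 3t survives when any three
  vertices are forbidden. If at most three arcs enter a member, their heads can be avoided, and then
  no cycle through the outside meets the chosen set. Four entering and four leaving arcs make 8
  links, more than a vertex can absorb when it is deleted, and too many for average degree at most 6
  inside the member. From then on \<open>h\<close> vanishes for every induced subgraph. Contraction
  is the one step that leaves the induced subgraphs, so there a member can reappear, but only
  through the contracted vertex; the same tolerance of three forbidden vertices deals with
  it.\<close>

definition acyc :: "('a \<times> 'a) set \<Rightarrow> 'a set \<Rightarrow> bool" where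
  "acyc E S \<longleftrightarrow> acyclic (Restr E S)"

definition links :: "('a \<times> 'a) set \<Rightarrow> 'a set \<Rightarrow> 'a set \<Rightarrow> ('a \<times> 'a) set" where
  "links E A B = E \<inter> (A \<times> B \<union> B \<times> A)"

text \<open>The family in place: \<open>E\<close> induces on \<open>K\<close> a graph of the family,
  so no isomorphic copies have to be moved around. In \<open>base\<close>, \<open>j + 7 - i\<close>
  is the difference modulo 7 without truncation; in \<open>join\<close>, a single link covers both
  directions of the added arc.\<close>

inductive paley_set :: "('a \<times> 'a) set \<Rightarrow> 'a set \<Rightarrow> bool" for E where
  base: "bij_betw f {0..<7::nat} K \<Longrightarrow>
     (\<And>i j. i < 7 \<Longrightarrow> j < 7 \<Longrightarrow> (f i, f j) \<in> E \<longleftrightarrow> (j + 7 - i) mod 7 \<in> {1, 2, 4}) \<Longrightarrow> paley_set E K"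
| join: "paley_set E A \<Longrightarrow> paley_set E B \<Longrightarrow> A \<inter> B = {} \<Longrightarrow> card (links E A B) = 1 \<Longrightarrow>
     paley_set E (A \<union> B)"

text \<open>The components that belong to the family: \<open>K\<close> is connected, so having no arcs to the rest of
  \<open>V\<close> makes it a component.\<close>

definition paley_parts :: "('a \<times> 'a) set \<Rightarrow> 'a set \<Rightarrow> 'a set set" where
  "paley_parts E V = {K. K \<subseteq> V \<and> paley_set E K \<and> links E K (V - K) = {}}"

text \<open>The claimed inequality, with truncated subtraction avoided by moving everything to the
  larger side.\<close>

definition bound :: "('a \<times> 'a) set \<Rightarrow> 'a set \<Rightarrow> bool" where
  "bound E V \<longleftrightarrow> (\<exists>S\<subseteq>V. acyc E S \<and>
     7 * card V \<le> 9 * card S + card (Restr E V) + card (paley_parts E V))"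

lemma links_commute: "links E A B = links E B A"
  by (auto simp: links_def)

lemma links_converse: "links (E\<inverse>) A B = (links E A B)\<inverse>"
  by (auto simp: links_def)

lemma links_converse_empty [simp]: "links (E\<inverse>) A B = {} \<longleftrightarrow> links E A B = {}"
  by (auto simp: links_def)

lemma acyc_converse [simp]: "acyc (E\<inverse>) S \<longleftrightarrow> acyc E S"
proof -
  have "Restr (E\<inverse>) S = (Restr E S)\<inverse>" by auto
  then show ?thesis by (simp add: acyc_def)
qed

lemma acyc_empty [simp]: "acyc E {}"
  by (simp add: acyc_def acyclic_def)

text \<open>A walk that has entered \<open>T\<close> cannot leave it, so a cycle lies entirely in
  \<open>S\<close> or entirely in \<open>T\<close>.\<close>

lemma acyc_Un:
  assumes S: "acyc E S" and T: "acyc E T" and no: "E \<inter> T \<times> S = {}"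
  shows "acyc E (S \<union> T)"
proof -
  let ?R = "Restr E (S \<union> T)"
  have stays_T: "y \<in> T \<and> (x, y) \<in> (Restr E T)\<^sup>+" if "(x, y) \<in> ?R\<^sup>+" "x \<in> T" for x y
    using that
  proof (induction rule: trancl_induct)
    case (base y) then show ?case using no by auto
  next
    case (step y z)
    then have "z \<in> T" "(y, z) \<in> Restr E T" using no by auto
    with step show ?case by (meson trancl.trancl_into_trancl)
  qed
  have stays_S: "x \<in> S \<and> (x, y) \<in> (Restr E S)\<^sup>+" if "(x, y) \<in> ?R\<^sup>+" "y \<in> S" for x y
    using that
  proof (induction rule: converse_trancl_induct)
    case (base x) then show ?case using no by auto
  next
    case (step x z)
    then have "(x, z) \<in> Restr E S" using no by auto
    with step show ?case by (meson IntD2 SigmaD1 trancl_into_trancl2)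
  qed
  have False if "(x, x) \<in> ?R\<^sup>+" for x
  proof -
    from that have "x \<in> S \<union> T" by (meson IntD2 SigmaD1 converse_tranclE)
    then show False using stays_S[OF that] stays_T[OF that] S T
      by (auto simp: acyc_def acyclic_def)
  qed
  then show ?thesis by (auto simp: acyc_def acyclic_def)
qed

lemma acyc_singleton: "asym E \<Longrightarrow> acyc E {v}"
proof -
  assume "asym E"
  then have "Restr E {v} = {}" by (auto dest: asymD)
  then show ?thesis by (simp add: acyc_def acyclic_def)
qed

lemma acyc_insert_source:
  assumes "asym E" "acyc E S" "\<And>x. x \<in> S \<Longrightarrow> (x, v) \<notin> E"
  shows "acyc E (insert v S)"
  using acyc_Un[OF acyc_singleton[OF assms(1), of v] assms(2)] assms(3) by fastforce

lemma acyc_insert_sink: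
  assumes "asym E" "acyc E S" "\<And>x. x \<in> S \<Longrightarrow> (v, x) \<notin> E"
  shows "acyc E (insert v S)"
  using acyc_insert_source[of "E\<inverse>" S v] assms by simp

text \<open>Closure under reversal lets every statement about out-arcs of a counterexample be reused
  for in-arcs.\<close>

lemma paley_set_converse:
  assumes "paley_set E K" shows "paley_set (E\<inverse>) K"
  using assms
proof induction
  case (base f K)
  \<comment> \<open>negation on \<open>\<int>/7\<int>\<close> reverses all arcs, since \<open>-1\<close> is not a square modulo 7\<close>
  define g where "g i = f (if i = 0 then 0 else 7 - i)" for i :: nat
  have b: "bij_betw (\<lambda>i::nat. if i = 0 then 0 else 7 - i) {0..<7} {0..<7}"
    by (rule bij_betw_byWitness[where f' = "\<lambda>i. if i = 0 then 0 else 7 - i"]) auto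
  have "bij_betw g {0..<7} K"
    using bij_betw_trans[OF b base(1)] by (simp add: g_def[abs_def] o_def)
  moreover have "(g i, g j) \<in> E\<inverse> \<longleftrightarrow> (j + 7 - i) mod 7 \<in> {1, 2, 4}" if "i < 7" "j < 7" for i j
  proof -
    have "i \<in> {0,1,2,3,4,5,6}" "j \<in> {0,1,2,3,4,5,6}" using that by auto
    then show ?thesis unfolding g_def by (auto simp: base(2))
  qed
  ultimately show ?case by (rule paley_set.base)
next
  case (join A B)
  then show ?case by (intro paley_set.join) (auto simp: links_converse)
qed

lemma paley_set_converse_iff [simp]: "paley_set (E\<inverse>) K \<longleftrightarrow> paley_set E K"
  using paley_set_converse[of E K] paley_set_converse[of "E\<inverse>" K] by auto

lemma paley_parts_converse [simp]: "paley_parts (E\<inverse>) V = paley_parts E V"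
  by (simp add: paley_parts_def)

lemma card_Restr_converse [simp]: "card (Restr (E\<inverse>) V) = card (Restr E V)"
proof -
  have "Restr (E\<inverse>) V = (Restr E V)\<inverse>" by auto
  then show ?thesis by simp
qed

lemma bound_converse [simp]: "bound (E\<inverse>) V \<longleftrightarrow> bound E V"
  by (simp add: bound_def)

lemma paley_set_finite: "paley_set E K \<Longrightarrow> finite K"
  by (induction rule: paley_set.induct) (auto simp: bij_betw_finite[symmetric])

lemma paley_set_nonempty: "paley_set E K \<Longrightarrow> K \<noteq> {}"
  by (induction rule: paley_set.induct) (auto simp: bij_betw_def)

lemma paley_set_cong:
  assumes "paley_set E K" "\<And>x y. x \<in> K \<Longrightarrow> y \<in> K \<Longrightarrow> (x, y) \<in> E \<longleftrightarrow> (x, y) \<in> E'"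
  shows "paley_set E' K"
  using assms
proof induction
  case (base f K)
  have "f i \<in> K" if "i < 7" for i using base(1) that by (auto simp: bij_betw_def)
  then show ?case using base by (intro paley_set.base) auto
next
  case (join A B)
  have "links E' A B = links E A B" using join(7) by (auto simp: links_def)
  then show ?case using join by (intro paley_set.join) auto
qed

lemma card_Restr_Un:
  assumes "finite A" "finite B" "A \<inter> B = {}"
  shows "card (Restr E (A \<union> B)) = card (Restr E A) + card (Restr E B) + card (links E A B)"
proof -
  have "Restr E (A \<union> B) = (Restr E A \<union> Restr E B) \<union> links E A B" by (auto simp: links_def)
  moreover have "card (Restr E A \<union> Restr E B) = card (Restr E A) + card (Restr E B)"
    using assms by (intro card_Un_disjoint) auto
  moreover have "card ((Restr E A \<union> Restr E B) \<union> links E A B) =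
      card (Restr E A \<union> Restr E B) + card (links E A B)"
    using assms by (intro card_Un_disjoint) (auto simp: links_def)
  ultimately show ?thesis by simp
qed

section \<open>Arcs and transitive triangles of the Paley graph\<close>

text \<open>The set {1, 2, 4} is closed under doubling modulo 7, so a progression a, a + d, a + 2d
  is a transitive triangle. The enumeration finds one that avoids any three given vertices.\<close>

lemma paley7_transitive_triple_aux:
  "\<forall>x \<in> set [0..<7]. \<forall>y \<in> set [0..<7]. \<forall>z \<in> set [0..<7]. \<exists>a \<in> set [0..<7]. \<exists>d \<in> set [1, 2, 4::nat].
     list_all (\<lambda>w. w \<notin> set [x, y, z]) [a, (a + d) mod 7, (a + d + d) mod 7]"
  by code_simp

lemma paley7_arc_steps:
  "\<forall>a \<in> set [0..<7]. \<forall>d \<in> set [1, 2, 4::nat].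
     ((a + d) mod 7 + 7 - a) mod 7 \<in> {1, 2, 4} \<and>
     ((a + d + d) mod 7 + 7 - (a + d) mod 7) mod 7 \<in> {1, 2, 4} \<and>
     ((a + d + d) mod 7 + 7 - a) mod 7 \<in> {1, 2, 4} \<and>
     distinct [a, (a + d) mod 7, (a + d + d) mod 7]"
  by code_simp

lemma paley7_size:
  "length (filter (\<lambda>(i, j). (j + 7 - i) mod 7 \<in> {1, 2, 4::nat}) (List.product [0..<7] [0..<7])) = 21"
  by code_simp

lemma card_le_3_subset:
  assumes "finite B" "card B \<le> 3" "B \<subseteq> U" "U \<noteq> {}"
  shows "\<exists>x\<in>U. \<exists>y\<in>U. \<exists>z\<in>U. B \<subseteq> {x, y, z}"
proof -
  obtain u where u: "u \<in> U" using assms(4) by auto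
  obtain xs where xs: "set xs = B" "length xs = card B"
    using finite_distinct_list[OF assms(1)] distinct_card by metis
  show ?thesis
  proof (cases xs)
    case Nil then show ?thesis using xs u by auto
  next
    case (Cons x ys)
    note c1 = this
    show ?thesis
    proof (cases ys)
      case Nil then show ?thesis using xs c1 assms(3) by auto
    next
      case (Cons y zs)
      note c2 = this
      show ?thesis
      proof (cases zs)
        case Nil then show ?thesis using xs c1 c2 assms(3) by auto
      next
        case (Cons z ws)
        then have "ws = []" using xs(2) c1 c2 assms(2) by (cases ws) simp_all
        then show ?thesis using Cons xs c1 c2 assms(3) by auto
      qed
    qed
  qed
qed

text \<open>Any four vertices of the Paley graph contain a transitive triangle.\<close>

lemma paley_base_acyclic:
  assumes E: "asym E" and f: "bij_betw f {0..<7::nat} K"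
    and arcs: "\<And>i j. i < 7 \<Longrightarrow> j < 7 \<Longrightarrow> (f i, f j) \<in> E \<longleftrightarrow> (j + 7 - i) mod 7 \<in> {1, 2, 4}"
    and B: "finite B" "card B \<le> 3"
  shows "\<exists>S \<subseteq> K - B. acyc E S \<and> card S = 3"
proof -
  have inj: "inj_on f {0..<7}" and K: "K = f ` {0..<7}" using f by (auto simp: bij_betw_def)
  define C where "C = {i \<in> {0..<7}. f i \<in> B}"
  have "card C = card (f ` C)"
    using inj by (intro card_image[symmetric]) (auto simp: C_def inj_on_def)
  also have "\<dots> \<le> card B" using B(1) by (intro card_mono) (auto simp: C_def)
  finally have "card C \<le> 3" using B by simp
  moreover have "finite C" "C \<subseteq> {0..<7}" by (auto simp: C_def)
  ultimately have "\<exists>x\<in>{0..<7}. \<exists>y\<in>{0..<7}. \<exists>z\<in>{0..<7}. C \<subseteq> {x, y, z}"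
    by (intro card_le_3_subset) auto
  then obtain x y z where xyz: "x < 7" "y < 7" "z < 7" "C \<subseteq> {x, y, z}"
    by auto
  then obtain a d where a: "a \<in> set [0..<7]" and d: "d \<in> set [1, 2, 4::nat]" and
    n: "list_all (\<lambda>w. w \<notin> set [x, y, z]) [a, (a + d) mod 7, (a + d + d) mod 7]"
    using paley7_transitive_triple_aux by (metis atLeastLessThan_iff atLeastLessThan_upt le0)
  define b c where "b = (a + d) mod 7" and "c = (a + d + d) mod 7"
  have l: "a < 7" "b < 7" "c < 7" using a by (auto simp: b_def c_def)
  have "a \<notin> C" "b \<notin> C" "c \<notin> C" using n xyz(4) by (auto simp: b_def c_def)
  then have nB: "f a \<notin> B" "f b \<notin> B" "f c \<notin> B" using l by (auto simp: C_def)
  have st: "(f a, f b) \<in> E" "(f b, f c) \<in> E" "(f a, f c) \<in> E" "distinct [a, b, c]"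
    using paley7_arc_steps[rule_format, OF a d] l by (simp_all add: arcs b_def c_def)
  have dist: "f a \<noteq> f b" "f a \<noteq> f c" "f b \<noteq> f c"
    using st(4) l inj by (auto simp: inj_on_def)
  have "acyc E (insert (f a) (insert (f b) {f c}))"
    using E st by (intro acyc_insert_source acyc_singleton) (auto dest: asymD)
  moreover have "card {f a, f b, f c} = 3" using dist by simp
  moreover have "{f a, f b, f c} \<subseteq> K - B" using nB l by (auto simp: K)
  ultimately show ?thesis by blast
qed

lemma paley_base_card_arcs:
  assumes f: "bij_betw f {0..<7::nat} K"
    and arcs: "\<And>i j. i < 7 \<Longrightarrow> j < 7 \<Longrightarrow> (f i, f j) \<in> E \<longleftrightarrow> (j + 7 - i) mod 7 \<in> {1, 2, 4}"
  shows "card (Restr E K) = 21"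
proof -
  have inj: "inj_on f {0..<7}" and K: "K = f ` {0..<7}" using f by (auto simp: bij_betw_def)
  define xs where "xs = filter (\<lambda>(i, j). (j + 7 - i) mod 7 \<in> {1, 2, 4::nat}) (List.product [0..<7] [0..<7])"
  have xs: "set xs = {(i, j). i < 7 \<and> j < 7 \<and> (j + 7 - i) mod 7 \<in> {1, 2, 4}}"
    by (auto simp: xs_def)
  have "Restr E K = map_prod f f ` set xs"
    unfolding xs K by (auto simp: arcs map_prod_def image_iff) 
  moreover have "inj_on (map_prod f f) (set xs)"
    using inj by (auto simp: xs inj_on_def)
  moreover have "card (set xs) = 21"
    using distinct_card[of xs] paley7_size unfolding xs_def by (simp only: distinct_filter distinct_product distinct_upt simp_thms)
  ultimately show ?thesis by (simp add: card_image)
qed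

text \<open>Here \<open>t\<close> is the number of Paley copies: 21 arcs in each and t - 1 joining
  arcs give 22t - 1. The forbidden set \<open>B\<close> will be the set of vertices at which arcs
  from outside enter.\<close>

lemma paley_set_props:
  assumes "paley_set E K" "asym E"
  shows "\<exists>t\<ge>1. card K = 7 * t \<and> card (Restr E K) + 1 = 22 * t \<and>
    (\<forall>B. finite B \<longrightarrow> card B \<le> 3 \<longrightarrow> (\<exists>S \<subseteq> K - B. acyc E S \<and> card S = 3 * t))"
  using assms
proof induction
  case (base f K)
  have "card K = 7" using base(1) bij_betw_same_card by fastforce
  then show ?case using paley_base_acyclic[OF base(3,1,2)] paley_base_card_arcs[OF base(1,2)]
    by (intro exI[of _ 1]) auto
next
  case (join A B)
  note fin = paley_set_finite[OF join(1)] paley_set_finite[OF join(2)]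
  obtain s where s: "s \<ge> 1" "card A = 7 * s" "card (Restr E A) + 1 = 22 * s"
    "\<And>C. finite C \<Longrightarrow> card C \<le> 3 \<Longrightarrow> \<exists>S \<subseteq> A - C. acyc E S \<and> card S = 3 * s"
    using join(5)[OF join(7)] by blast
  obtain t where t: "t \<ge> 1" "card B = 7 * t" "card (Restr E B) + 1 = 22 * t"
    "\<And>C. finite C \<Longrightarrow> card C \<le> 3 \<Longrightarrow> \<exists>S \<subseteq> B - C. acyc E S \<and> card S = 3 * t"
    using join(6)[OF join(7)] by blast
  have "card (A \<union> B) = 7 * (s + t)" using fin join(3) s t by (simp add: card_Un_disjoint)
  moreover have "card (Restr E (A \<union> B)) + 1 = 22 * (s + t)"
    using card_Restr_Un[OF fin join(3), of E] join(4) s(3) t(3) by simp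
  moreover have "\<exists>S \<subseteq> A \<union> B - C. acyc E S \<and> card S = 3 * (s + t)" if C: "finite C" "card C \<le> 3" for C
  proof -
    obtain S where S: "S \<subseteq> A - C" "acyc E S" "card S = 3 * s" using s(4)[OF C] by blast
    obtain U where U: "U \<subseteq> B - C" "acyc E U" "card U = 3 * t" using t(4)[OF C] by blast
    have "acyc E (S \<union> U)"
    proof (cases "E \<inter> U \<times> S = {}")
      case True then show ?thesis using acyc_Un[OF S(2) U(2)] by simp
    next
      case False
      \<comment> \<open>The only link between \<open>A\<close> and \<open>B\<close> runs from
        \<open>U\<close> to \<open>S\<close>, so nothing runs back and \<open>acyc_Un\<close>
        applies with the two sets exchanged.\<close>
      then obtain p where p: "p \<in> E" "p \<in> U \<times> S" by blast
      obtain q where "links E A B = {q}" using join(4) by (meson card_1_singletonE)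
      moreover have "p \<in> links E A B" using p S U by (auto simp: links_def)
      ultimately have "links E A B = {p}" by auto
      then have only: "r = p" if "r \<in> E" "r \<in> A \<times> B" for r using that by (auto simp: links_def)
      have "E \<inter> S \<times> U = {}"
      proof (rule ccontr)
        assume "E \<inter> S \<times> U \<noteq> {}"
        then obtain r where r: "r \<in> E" "r \<in> S \<times> U" by blast
        then have "r \<in> A \<times> B" using S(1) U(1) by auto
        then have "p \<in> S \<times> U" using only[of r] r by simp
        then show False using p(2) S(1) U(1) join(3) by auto
      qed
      then show ?thesis using acyc_Un[OF U(2) S(2)] by (simp add: Un_commute)
    qed
    moreover have "card (S \<union> U) = 3 * (s + t)"
      using S U join(3) fin by (subst card_Un_disjoint) (auto intro: finite_subset)
    moreover have "S \<union> U \<subseteq> A \<union> B - C" using S U by auto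
    ultimately show ?thesis by blast
  qed
  ultimately show ?case using s(1) by (intro exI[of _ "s + t"]) auto
qed

text \<open>Connectedness without paths: in the Paley graph consecutive vertices are adjacent, and
  in a join a set that contains one side and misses the other is left by the joining arc.\<close>

lemma paley_set_connected:
  assumes "paley_set E K" "asym E" "A \<subseteq> K" "links E A (K - A) = {}"
  shows "A = {} \<or> A = K"
  using assms
proof (induction arbitrary: A)
  case (base f K)
  have K: "K = f ` {0..<7}" using base(1) by (auto simp: bij_betw_def)
  have st: "f i \<in> A \<longleftrightarrow> f (Suc i) \<in> A" if "Suc i < 7" for i
  proof -
    have e: "(f i, f (Suc i)) \<in> E" using that base(2)[of i "Suc i"] by simp
    have "f i \<in> K" "f (Suc i) \<in> K" using that by (auto simp: K)
    then show ?thesis using e base(5) by (auto simp: links_def)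
  qed
  have all: "f i \<in> A \<longleftrightarrow> f 0 \<in> A" if "i < 7" for i
    using that by (induction i) (auto simp: st)
  show ?case
  proof (cases "f 0 \<in> A")
    case True then have "K \<subseteq> A" using all unfolding K by (metis atLeastLessThan_iff image_subsetI)
    then show ?thesis using base(4) by auto
  next
    case False then have "K \<inter> A = {}" 
    proof -
      have "f i \<notin> A" if "i \<in> {0..<7}" for i using all[of i] False that by simp
      then show ?thesis unfolding K by blast
    qed
    then show ?thesis using base(4) by auto
  qed
next
  case (join P Q)
  have sub: "links E (A \<inter> R) (R - (A \<inter> R)) \<subseteq> links E A (P \<union> Q - A)" if "R \<subseteq> P \<union> Q" for R
    using that by (auto simp: links_def)
  have "links E (A \<inter> P) (P - (A \<inter> P)) = {}" "links E (A \<inter> Q) (Q - (A \<inter> Q)) = {}"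
    using sub[of P] sub[of Q] join(9) by auto
  then have PQ: "A \<inter> P = {} \<or> A \<inter> P = P" "A \<inter> Q = {} \<or> A \<inter> Q = Q"
    using join(5)[of "A \<inter> P"] join(6)[of "A \<inter> Q"] join(7) by auto
  obtain q where q: "links E P Q = {q}" using join(4) by (meson card_1_singletonE)
  have ne: "P \<subseteq> A \<Longrightarrow> A \<inter> Q = {} \<Longrightarrow> False" "Q \<subseteq> A \<Longrightarrow> A \<inter> P = {} \<Longrightarrow> False"
  proof -
    assume "P \<subseteq> A" "A \<inter> Q = {}"
    then have "links E P Q \<subseteq> links E A (P \<union> Q - A)" by (auto simp: links_def)
    then show False using q join(9) by simp
  next
    assume "Q \<subseteq> A" "A \<inter> P = {}"
    then have "links E P Q \<subseteq> links E A (P \<union> Q - A)" by (auto simp: links_def)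
    then show False using q join(9) by simp
  qed
  show ?case using PQ ne join(8) by blast
qed

text \<open>An arc from \<open>K \<inter> L\<close> to the rest of \<open>K\<close> would leave
  \<open>L\<close>, so \<open>K \<inter> L\<close> is closed in the connected
  \<open>K\<close>.\<close>

lemma paley_parts_disjoint:
  assumes "asym E" "K \<in> paley_parts E V" "L \<in> paley_parts E V" "K \<inter> L \<noteq> {}"
  shows "K = L"
proof -
  have *: "K \<subseteq> L" if "K \<in> paley_parts E V" "L \<in> paley_parts E V" "K \<inter> L \<noteq> {}" for K L
  proof -
    have "links E (K \<inter> L) (K - (K \<inter> L)) \<subseteq> links E L (V - L)"
      using that by (auto simp: paley_parts_def links_def)
    then have "links E (K \<inter> L) (K - (K \<inter> L)) = {}"
      using that by (auto simp: paley_parts_def)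
    then show ?thesis
      using paley_set_connected[of E K "K \<inter> L"] that assms(1) by (auto simp: paley_parts_def)
  qed
  show ?thesis using *[of K L] *[of L K] assms by auto
qed

section \<open>Minimal counterexamples\<close>

definition outdeg :: "('a \<times> 'a) set \<Rightarrow> 'a \<Rightarrow> nat" where
  "outdeg E v = card (E `` {v})"

definition indeg :: "('a \<times> 'a) set \<Rightarrow> 'a \<Rightarrow> nat" where
  "indeg E v = card (E\<inverse> `` {v})"

abbreviation deg :: "('a \<times> 'a) set \<Rightarrow> 'a \<Rightarrow> nat" where
  "deg E v \<equiv> indeg E v + outdeg E v"

lemma outdeg_converse [simp]: "outdeg (E\<inverse>) v = indeg E v"
  by (simp add: outdeg_def indeg_def)

lemma indeg_converse [simp]: "indeg (E\<inverse>) v = outdeg E v"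
  by (simp add: outdeg_def indeg_def)

lemma asym_converse: "asym E \<Longrightarrow> asym (E\<inverse>)"
  by (auto intro!: asymI dest: asymD)

lemma closed_trans:
  assumes "K \<subseteq> B" "links E K (B - K) = {}" "links E B (V - B) = {}"
  shows "links E K (V - K) = {}"
proof -
  have "links E K (V - K) \<subseteq> links E K (B - K) \<union> links E B (V - B)"
    using assms(1) unfolding links_def by blast
  then show ?thesis using assms(2,3) by simp
qed

text \<open>Minimality ranges over all asymmetric relations on smaller sets, not only over induced
  subgraphs, because \<open>out_pair_triangle\<close> applies it to a contracted graph. The relation
  \<open>E'\<close> may reach outside \<open>V'\<close>, as \<open>bound\<close> looks only at arcs
  inside the set.\<close>

locale min_cex =
  fixes V :: "'a set" and E :: "('a \<times> 'a) set"
  assumes fin: "finite V" and E_sub: "E \<subseteq> V \<times> V" and asym: "asym E" and cex: "\<not> bound E V"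
    and minimal: "\<And>(V' :: 'a set) E'. finite V' \<Longrightarrow> asym E' \<Longrightarrow> card V' < card V \<Longrightarrow> bound E' V'"
begin

lemma converse: "min_cex V (E\<inverse>)"
proof
  show "finite V" "asym (E\<inverse>)" "\<not> bound (E\<inverse>) V" using fin asym cex by (simp_all add: asym_converse)
  show "E\<inverse> \<subseteq> V \<times> V" using E_sub by auto
  show "bound E' V'" if "finite V'" "asym E'" "card V' < card V" for V' :: "'a set" and E'
    using that by (rule minimal)
qed

lemma fin_E: "finite E"
  using fin E_sub finite_subset by blast

lemma Restr_V [simp]: "Restr E V = E"
  using E_sub by auto

lemma no_loop: "(v, v) \<notin> E"
  using asymD[OF asym] by blast

lemma no_digon: "(u, v) \<in> E \<Longrightarrow> (v, u) \<notin> E"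
  using asymD[OF asym] by blast

lemma fin_parts: "W \<subseteq> V \<Longrightarrow> finite (paley_parts E W)"
  by (rule finite_subset[of _ "Pow V"]) (use fin in \<open>auto simp: paley_parts_def\<close>)

lemma too_few:
  assumes "S \<subseteq> V" "acyc E S"
  shows "9 * card S + card E + card (paley_parts E V) < 7 * card V"
  using cex assms unfolding bound_def Restr_V by (meson not_le)

text \<open>A witness of the bound for \<open>V - X\<close>, extended by \<open>S\<close>, must
  still be too small for \<open>V\<close>; subtracting leaves only the contribution of
  \<open>X\<close>. The two part counts stay, since removing \<open>X\<close> may create new
  components of the family.\<close>

lemma reduction_general:
  assumes X: "X \<subseteq> V" "X \<noteq> {}" and S: "S \<subseteq> X"
    and safe: "\<And>T. T \<subseteq> V - X \<Longrightarrow> acyc E T \<Longrightarrow> acyc E (T \<union> S)"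
  shows "9 * card S + card (E - Restr E (V - X)) + card (paley_parts E V) <
    7 * card X + card (paley_parts E (V - X))"
proof -
  have "card (V - X) < card V" using X fin by (intro psubset_card_mono) auto
  then have "bound E (V - X)" using minimal[OF _ asym] fin by simp
  then obtain T where T: "T \<subseteq> V - X" "acyc E T"
    "7 * card (V - X) \<le> 9 * card T + card (Restr E (V - X)) + card (paley_parts E (V - X))"
    unfolding bound_def by blast
  have fins: "finite T" "finite S" using T(1) X S fin by (meson finite_subset finite_Diff)+
  have "card (T \<union> S) = card T + card S" using T(1) S fins by (intro card_Un_disjoint) auto
  then have "9 * (card T + card S) + card E + card (paley_parts E V) < 7 * card V"
    using too_few[OF _ safe[OF T(1,2)]] T(1) S X by (metis Un_subset_iff Diff_subset order_trans)
  moreover have "card E = card (Restr E (V - X)) + card (E - Restr E (V - X))"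
    using fin_E by (simp add: card_Diff_subset card_mono)
  moreover have "card V = card X + card (V - X)"
    using X fin by (simp add: card_Diff_subset card_mono finite_subset)
  moreover have "9 * s + m + p < 7 * x + q"
    if "9 * (t + s) + e + p < 7 * v" "e = r + m" "v = x + y" "7 * y \<le> 9 * t + r + q"
    for e m p q r s t v x y :: nat
    using that by simp
  ultimately show ?thesis using T(3) by blast
qed

text \<open>All quantities add up over a union without links, and a family component of either side
  is one of \<open>V\<close>, so two bounds would combine to the bound for \<open>V\<close>.\<close>

lemma connected:
  assumes A: "A \<subseteq> V" "A \<noteq> {}" "A \<noteq> V" and no: "links E A (V - A) = {}"
  shows False
proof -
  have finA: "finite A" using A fin finite_subset by auto
  have "card A < card V" "card (V - A) < card V" using A fin by (auto intro!: psubset_card_mono)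
  then have "bound E A" "bound E (V - A)" using minimal[OF _ asym] fin finA by simp_all
  then obtain S T where S: "S \<subseteq> A" "acyc E S"
      "7 * card A \<le> 9 * card S + card (Restr E A) + card (paley_parts E A)"
    and T: "T \<subseteq> V - A" "acyc E T"
      "7 * card (V - A) \<le> 9 * card T + card (Restr E (V - A)) + card (paley_parts E (V - A))"
    unfolding bound_def by blast
  have VA: "A \<union> (V - A) = V" using A by auto
  have "card E = card (Restr E A) + card (Restr E (V - A))"
    using card_Restr_Un[OF finA, of "V - A" E] fin no VA by simp
  moreover have "card V = card A + card (V - A)"
    using A fin finA by (simp add: card_Diff_subset card_mono)
  moreover have "card (S \<union> T) = card S + card T"
    using S T fin finA by (intro card_Un_disjoint) (auto intro: finite_subset)
  moreover have "acyc E (S \<union> T)"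
    using S T no by (intro acyc_Un) (auto simp: links_def)
  moreover have "card (paley_parts E A) + card (paley_parts E (V - A)) \<le> card (paley_parts E V)"
  proof -
    have "paley_parts E A \<inter> paley_parts E (V - A) = {}"
      using paley_set_nonempty unfolding paley_parts_def by blast
    then have "card (paley_parts E A) + card (paley_parts E (V - A)) =
        card (paley_parts E A \<union> paley_parts E (V - A))"
      using fin_parts A by (subst card_Un_disjoint) auto
    also have "\<dots> \<le> card (paley_parts E V)"
    proof (rule card_mono[OF fin_parts])
      have "V - (V - A) = A" using A by auto
      then have B: "links E B (V - B) = {}" if "B = A \<or> B = V - A" for B
        using that no by (auto simp: links_commute[of E "V - A" A])
      have "K \<in> paley_parts E V" if K: "K \<in> paley_parts E B" "B = A \<or> B = V - A" for K B
      proof -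
        have "K \<subseteq> B" "paley_set E K" "links E K (B - K) = {}" using K(1) by (simp_all add: paley_parts_def)
        moreover have "B \<subseteq> V" using K(2) A by (elim disjE) simp_all
        ultimately show ?thesis using closed_trans[OF _ _ B[OF K(2)]] by (simp add: paley_parts_def)
      qed
      then show "paley_parts E A \<union> paley_parts E (V - A) \<subseteq> paley_parts E V" by blast
    qed simp
    finally show ?thesis .
  qed
  moreover have "S \<union> T \<subseteq> V" using S(1) T(1) A by auto
  ultimately show False using too_few[of "S \<union> T"] S(3) T(3) by simp
qed

lemma V_not_paley: "\<not> paley_set E V"
proof
  assume V: "paley_set E V"
  then obtain t where t: "card V = 7 * t" "card (Restr E V) + 1 = 22 * t"
     "\<forall>B. finite B \<longrightarrow> card B \<le> 3 \<longrightarrow> (\<exists>S \<subseteq> V - B. acyc E S \<and> card S = 3 * t)"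
    using paley_set_props[OF V asym] by blast
  then obtain S where S: "S \<subseteq> V" "acyc E S" "card S = 3 * t" using t(3)[rule_format, of "{}"] by auto
  have "V \<in> paley_parts E V" using V by (auto simp: paley_parts_def links_def)
  then have "card (paley_parts E V) \<ge> 1"
    using fin_parts[of V] by (metis One_nat_def Suc_leI card_gt_0_iff empty_iff order_refl)
  then show False using too_few[OF S(1,2)] S(3) t by simp
qed

lemma parts_sub: "W \<subset> V \<Longrightarrow> K \<in> paley_parts E W \<Longrightarrow> K \<subset> V \<and> paley_set E K"
  by (auto simp: paley_parts_def)

section \<open>Members of the family inside a minimal counterexample\<close>

lemma links_parts_nonempty:
  assumes W: "W \<subset> V" and K: "K \<in> paley_parts E W"
  shows "links E K (V - W) \<noteq> {}"
proof
  assume "links E K (V - W) = {}"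
  moreover have KW: "K \<subseteq> W" "paley_set E K" "links E K (W - K) = {}" using K by (auto simp: paley_parts_def)
  moreover have "links E K (V - K) \<subseteq> links E K (W - K) \<union> links E K (V - W)"
    unfolding links_def by blast
  ultimately have "links E K (V - K) = {}" by simp
  moreover have "K \<subseteq> V" "K \<noteq> V" using KW W by auto
  ultimately show False using connected[of K] paley_set_nonempty[OF KW(2)] by simp
qed

lemma sum_links_parts:
  assumes W: "W \<subset> V" and F: "F \<subseteq> paley_parts E W"
  shows "(\<Sum>K\<in>F. card (links E K (V - W))) = card (links E (\<Union>F) (V - W))"
proof -
  have "links E (\<Union>F) (V - W) = (\<Union>K\<in>F. links E K (V - W))" by (auto simp: links_def)
  moreover have "card (\<Union>K\<in>F. links E K (V - W)) = (\<Sum>K\<in>F. card (links E K (V - W)))"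
  proof (rule card_UN_disjoint)
    show "finite F" using F fin_parts W finite_subset by blast
    show "\<forall>K\<in>F. finite (links E K (V - W))" using fin_E by (auto simp: links_def)
    show "\<forall>K\<in>F. \<forall>L\<in>F. K \<noteq> L \<longrightarrow> links E K (V - W) \<inter> links E L (V - W) = {}"
    proof (intro ballI impI)
      fix K L assume "K \<in> F" "L \<in> F" "K \<noteq> L"
      moreover from this have "K \<inter> L = {}" using paley_parts_disjoint[OF asym] F by blast
      moreover have "K \<subseteq> W" "L \<subseteq> W" using calculation F by (auto simp: paley_parts_def)
      ultimately show "links E K (V - W) \<inter> links E L (V - W) = {}" by (auto simp: links_def)
    qed
  qed
  ultimately show ?thesis by simp
qed

text \<open>Distinct parts are not linked to each other, so each new part meets the union built so
  far in its one link to \<open>K\<close>, and \<open>join\<close> can be iterated.\<close>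

lemma paley_join_parts:
  assumes K: "paley_set E K" "K \<subset> V"
    and one: "\<And>A. A \<in> paley_parts E (V - K) \<Longrightarrow> card (links E A K) = 1"
    and F: "finite F" "F \<subseteq> paley_parts E (V - K)"
  shows "paley_set E (K \<union> \<Union>F)"
  using F
proof (induction F)
  case empty then show ?case using K by simp
next
  case (insert A F)
  have A: "paley_set E A" "A \<subseteq> V - K" "links E A (V - K - A) = {}"
    using insert(4) by (auto simp: paley_parts_def)
  have disj: "A \<inter> \<Union>F = {}"
    using paley_parts_disjoint[OF asym] insert(2,4) by blast
  moreover have "\<Union>F \<subseteq> V - K" using insert(4) by (auto simp: paley_parts_def)
  ultimately have "links E (K \<union> \<Union>F) A = links E A K \<union> links E A (\<Union>F)" "links E A (\<Union>F) \<subseteq> links E A (V - K - A)"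
    by (auto simp: links_def)
  then have one': "card (links E (K \<union> \<Union>F) A) = 1" using A(3) one insert(4) by auto
  have "paley_set E ((K \<union> \<Union>F) \<union> A)"
  proof (rule paley_set.join[OF _ A(1) _ one'])
    show "paley_set E (K \<union> \<Union>F)" using insert by simp
    show "(K \<union> \<Union>F) \<inter> A = {}" using A(2) disj by auto
  qed
  then show ?case by (simp add: Un_ac)
qed

text \<open>Every part outside \<open>K\<close> is joined to \<open>K\<close>. With at most as many arcs as parts, each would be
  joined by exactly one arc and all of \<open>V\<close> would belong to the family.\<close>

lemma parts_outside_paley:
  assumes K: "paley_set E K" "K \<subset> V"
  shows "card (paley_parts E (V - K)) < card (links E K (V - K))"
proof (rule ccontr)
  let ?F = "paley_parts E (V - K)"
  have KK: "V - (V - K) = K" and W: "V - K \<subset> V" using K paley_set_nonempty by auto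
  assume "\<not> ?thesis"
  then have le: "card (links E K (V - K)) \<le> card ?F" by simp
  have finF: "finite ?F" using fin_parts by simp
  have finl: "finite (links E K (V - K))" using fin_E by (auto simp: links_def)
  have pos: "card (links E A K) \<ge> 1" if "A \<in> ?F" for A
  proof -
    have "links E A K \<noteq> {}" using links_parts_nonempty[OF W that] KK by simp
    moreover have "finite (links E A K)" using fin_E by (auto simp: links_def)
    ultimately show ?thesis by (simp add: Suc_leI card_gt_0_iff)
  qed
  have sub: "links E (\<Union>?F) K \<subseteq> links E K (V - K)" by (auto simp: links_def paley_parts_def)
  have sum: "(\<Sum>A\<in>?F. card (links E A K)) = card (links E (\<Union>?F) K)"
    using sum_links_parts[OF W, of ?F] KK by simp
  have "card (links E (\<Union>?F) K) \<le> card ?F"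
    using card_mono[OF finl sub] le by simp
  have one: "card (links E A K) = 1" if A: "A \<in> ?F" for A
  proof (rule ccontr)
    assume "card (links E A K) \<noteq> 1"
    then have "1 < card (links E A K)" using pos[OF A] by simp
    then have "(\<Sum>A\<in>?F. 1) < (\<Sum>A\<in>?F. card (links E A K))"
      using pos finF A by (intro sum_strict_mono_ex1) auto
    then show False using sum \<open>card (links E (\<Union>?F) K) \<le> card ?F\<close> by simp
  qed
  have "card (links E (\<Union>?F) K) = card ?F" using sum one by simp
  \<comment> \<open>Equality of the counts means that every arc leaving \<open>K\<close> ends in a
    part, so \<open>K\<close> together with all parts has no arcs to the rest.\<close>
  then have eq: "links E (\<Union>?F) K = links E K (V - K)"
    using card_seteq[OF finl sub] le by simp
  let ?U = "K \<union> \<Union>?F"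
  have pU: "paley_set E ?U" using paley_join_parts[OF K one finF] by simp
  have UV: "?U \<subseteq> V" using K by (auto simp: paley_parts_def)
  have "links E ?U (V - ?U) = {}"
  proof (rule ccontr)
    assume "links E ?U (V - ?U) \<noteq> {}"
    then obtain p where p: "p \<in> links E ?U (V - ?U)" by blast
    then have "p \<in> links E K (V - ?U) \<or> (\<exists>A\<in>?F. p \<in> links E A (V - ?U))" by (auto simp: links_def)
    then show False
    proof
      assume p: "p \<in> links E K (V - ?U)"
      then have "p \<in> links E (\<Union>?F) K" unfolding eq by (auto simp: links_def)
      then show False using p by (auto simp: links_def)
    next
      assume "\<exists>A\<in>?F. p \<in> links E A (V - ?U)"
      then obtain A where A: "A \<in> ?F" "p \<in> links E A (V - ?U)" by blast
      then have "p \<in> links E A (V - K - A)" by (auto simp: links_def)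
      then show False using A(1) by (auto simp: paley_parts_def)
    qed
  qed
  then have "?U = V" using connected[OF UV] paley_set_nonempty[OF K(1)] by auto
  then show False using pU V_not_paley by simp
qed

lemma paley_in_arcs:
  assumes K: "paley_set E K" "K \<subset> V"
  shows "card (E \<inter> (V - K) \<times> K) \<ge> 4"
proof (rule ccontr)
  assume "\<not> ?thesis"
  then have "card (E \<inter> (V - K) \<times> K) \<le> 3" by simp
  moreover have "card (snd ` (E \<inter> (V - K) \<times> K)) \<le> card (E \<inter> (V - K) \<times> K)"
    using fin_E by (intro card_image_le) auto
  ultimately have B: "card (snd ` (E \<inter> (V - K) \<times> K)) \<le> 3" by simp
  obtain t where t: "card K = 7 * t" "card (Restr E K) + 1 = 22 * t"
     "\<forall>B. finite B \<longrightarrow> card B \<le> 3 \<longrightarrow> (\<exists>S \<subseteq> K - B. acyc E S \<and> card S = 3 * t)"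
    using paley_set_props[OF K(1) asym] by blast
  have "finite (snd ` (E \<inter> (V - K) \<times> K))" using fin_E by simp
  then obtain S where S: "S \<subseteq> K - snd ` (E \<inter> (V - K) \<times> K)" "acyc E S" "card S = 3 * t"
    using t(3)[rule_format, OF _ B] by blast
  have no: "E \<inter> (V - K) \<times> S = {}" using S(1) by force
  have "9 * card S + card (E - Restr E (V - K)) + card (paley_parts E V) <
      7 * card K + card (paley_parts E (V - K))"
  proof (rule reduction_general)
    show "K \<subseteq> V" "K \<noteq> {}" "S \<subseteq> K" using K paley_set_nonempty S by auto
    show "acyc E (T \<union> S)" if "T \<subseteq> V - K" "acyc E T" for T
    proof -
      have "E \<inter> T \<times> S = {}" using no that(1) by blast
      then show ?thesis using acyc_Un[OF S(2) that(2)] by (simp add: Un_commute)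
    qed
  qed
  moreover have "card (E - Restr E (V - K)) = card (Restr E K) + card (links E K (V - K))"
  proof -
    have "E - Restr E (V - K) = Restr E K \<union> links E K (V - K)"
      using E_sub by (auto simp: links_def)
    moreover have "card (Restr E K \<union> links E K (V - K)) = card (Restr E K) + card (links E K (V - K))"
      using fin_E by (intro card_Un_disjoint) (auto simp: links_def)
    ultimately show ?thesis by simp
  qed
  \<comment> \<open>With L links and q outside parts the inequality reads 27t + (22t - 1) + L < 49t
    + q up to a nonnegative term on the left, so L is at most q, against
    \<open>parts_outside_paley\<close>.\<close>
  ultimately show False using t S(3) parts_outside_paley[OF K] by linarith
qed

lemma paley_links:
  assumes K: "paley_set E K" "K \<subset> V"
  shows "card (links E K (V - K)) \<ge> 8"
proof -
  interpret rev: min_cex V "E\<inverse>" by (rule converse)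
  have "E\<inverse> \<inter> (V - K) \<times> K = (E \<inter> K \<times> (V - K))\<inverse>" by auto
  then have "card (E \<inter> K \<times> (V - K)) \<ge> 4" using rev.paley_in_arcs[of K] K by simp
  moreover have "links E K (V - K) = (E \<inter> K \<times> (V - K)) \<union> (E \<inter> (V - K) \<times> K)"
    by (auto simp: links_def)
  moreover have "card ((E \<inter> K \<times> (V - K)) \<union> (E \<inter> (V - K) \<times> K)) =
     card (E \<inter> K \<times> (V - K)) + card (E \<inter> (V - K) \<times> K)"
    using fin_E by (intro card_Un_disjoint) auto
  ultimately show ?thesis using paley_in_arcs[OF K] by simp
qed

section \<open>Maximum degree and the end of the family\<close>

lemma card_touching:
  shows "card (E \<inter> ({v} \<times> UNIV \<union> UNIV \<times> {v})) = deg E v"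
proof -
  have "E \<inter> ({v} \<times> UNIV \<union> UNIV \<times> {v}) = Pair v ` (E `` {v}) \<union> (\<lambda>u. (u, v)) ` (E\<inverse> `` {v})"
    by auto
  moreover have "card (Pair v ` (E `` {v}) \<union> (\<lambda>u. (u, v)) ` (E\<inverse> `` {v})) =
     card (Pair v ` (E `` {v})) + card ((\<lambda>u. (u, v)) ` (E\<inverse> `` {v}))"
  proof (rule card_Un_disjoint)
    show "finite (Pair v ` (E `` {v}))" "finite ((\<lambda>u. (u, v)) ` (E\<inverse> `` {v}))"
      using fin_E by (auto intro!: finite_imageI finite_Image)
  qed (use no_loop in auto)
  moreover have "card (Pair v ` (E `` {v})) = outdeg E v" "card ((\<lambda>u. (u, v)) ` (E\<inverse> `` {v})) = indeg E v"
    by (simp_all add: card_image inj_on_def outdeg_def indeg_def)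
  ultimately show ?thesis by simp
qed

text \<open>Deleting \<open>v\<close> and keeping nothing costs 7, so only newly created parts could
  allow degree 7 or more; each of them consumes at least 8 arcs at \<open>v\<close>.\<close>

lemma deg_le_6:
  assumes v: "v \<in> V" shows "deg E v \<le> 6"
proof -
  let ?W = "V - {v}"
  have W: "?W \<subset> V" and V: "V - ?W = {v}" using v by auto
  have m: "E - Restr E ?W = E \<inter> ({v} \<times> UNIV \<union> UNIV \<times> {v})" using E_sub by auto
  have "9 * card ({} :: 'a set) + card (E - Restr E ?W) + card (paley_parts E V) <
      7 * card {v} + card (paley_parts E ?W)"
    using v by (intro reduction_general) auto
  then have less: "deg E v < 7 + card (paley_parts E ?W)" unfolding m card_touching by simp
  have "8 \<le> card (links E K {v})" if K: "K \<in> paley_parts E ?W" for K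
  proof -
    have "links E K (V - K) = links E K {v}"
      using K v by (auto simp: paley_parts_def links_def)
    then show ?thesis using paley_links[of K] parts_sub[OF W K] by simp
  qed
  then have "8 * card (paley_parts E ?W) \<le> (\<Sum>K\<in>paley_parts E ?W. card (links E K {v}))"
    using sum_bounded_below[of "paley_parts E ?W" 8 "\<lambda>K. card (links E K {v})"] by (simp add: mult.commute)
  also have "\<dots> = card (links E (\<Union>(paley_parts E ?W)) {v})"
    using sum_links_parts[OF W, of "paley_parts E ?W"] V by simp
  also have "\<dots> \<le> deg E v"
    unfolding card_touching[symmetric] using fin_E by (intro card_mono) (auto simp: links_def)
  \<comment> \<open>With q parts, 8q is at most the degree, which is below 7 + q; hence q =
    0.\<close>
  finally show ?thesis using less by linarith
qed

lemma sum_deg: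
  assumes "K \<subseteq> V"
  shows "(\<Sum>v\<in>K. deg E v) = 2 * card (Restr E K) + card (links E K (V - K))"
proof -
  have finK: "finite K" using assms fin finite_subset by auto
  have "(\<Sum>v\<in>K. outdeg E v) = card (Sigma K (\<lambda>v. E `` {v}))"
    using finK fin_E by (simp add: outdeg_def finite_Image)
  also have "Sigma K (\<lambda>v. E `` {v}) = Restr E K \<union> E \<inter> K \<times> (V - K)" using E_sub by auto
  also have "card \<dots> = card (Restr E K) + card (E \<inter> K \<times> (V - K))"
    using fin_E by (intro card_Un_disjoint) auto
  finally have o: "(\<Sum>v\<in>K. outdeg E v) = card (Restr E K) + card (E \<inter> K \<times> (V - K))" .
  have "(\<Sum>v\<in>K. indeg E v) = card (Sigma K (\<lambda>v. E\<inverse> `` {v}))"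
    using finK fin_E by (simp add: indeg_def finite_Image)
  also have "Sigma K (\<lambda>v. E\<inverse> `` {v}) = (Restr E K \<union> E \<inter> (V - K) \<times> K)\<inverse>" using E_sub by auto
  also have "card \<dots> = card (Restr E K) + card (E \<inter> (V - K) \<times> K)"
    unfolding card_inverse using fin_E by (intro card_Un_disjoint) auto
  finally have i: "(\<Sum>v\<in>K. indeg E v) = card (Restr E K) + card (E \<inter> (V - K) \<times> K)" .
  have "links E K (V - K) = E \<inter> K \<times> (V - K) \<union> E \<inter> (V - K) \<times> K" by (auto simp: links_def)
  moreover have "card (E \<inter> K \<times> (V - K) \<union> E \<inter> (V - K) \<times> K) = card (E \<inter> K \<times> (V - K)) + card (E \<inter> (V - K) \<times> K)"
    using fin_E by (intro card_Un_disjoint) auto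
  ultimately show ?thesis using o i by (simp add: sum.distrib)
qed

lemma no_paley:
  assumes "K \<subseteq> V" shows "\<not> paley_set E K"
proof
  assume K: "paley_set E K"
  then have KV: "K \<subset> V" using assms V_not_paley by auto
  obtain t where t: "t \<ge> 1" "card K = 7 * t" "card (Restr E K) + 1 = 22 * t"
    using paley_set_props[OF K asym] by blast
  have "(\<Sum>v\<in>K. deg E v) \<le> card K * 6"
    using sum_bounded_above[of K "deg E" 6] deg_le_6 assms by auto
  \<comment> \<open>The degree sum is at most 42t, but arcs and links force at least 2(22t - 1) + 8
    = 44t + 6.\<close>
  then show False using sum_deg[OF assms] paley_links[OF K KV] t by linarith
qed

lemma no_parts: "W \<subseteq> V \<Longrightarrow> paley_parts E W = {}"
  using no_paley by (fastforce simp: paley_parts_def)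

lemma reduction:
  assumes "X \<subseteq> V" "X \<noteq> {}" "S \<subseteq> X"
    and "\<And>T. T \<subseteq> V - X \<Longrightarrow> acyc E T \<Longrightarrow> acyc E (T \<union> S)"
  shows "9 * card S + card (E - Restr E (V - X)) < 7 * card X"
proof -
  have "paley_parts E (V - X) = {}" "paley_parts E V = {}" by (intro no_parts; blast)+
  then show ?thesis using reduction_general[OF assms] by simp
qed

end

section \<open>Local reductions\<close>

text \<open>Deleting \<open>R\<close> turns the vertices of the list, one after the other, into sources or sinks.\<close>

fun peelable :: "('a \<times> 'a) set \<Rightarrow> 'a set \<Rightarrow> 'a list \<Rightarrow> bool" where
  "peelable E R [] \<longleftrightarrow> True"
| "peelable E R (v # vs) \<longleftrightarrow> (E `` {v} \<subseteq> R \<or> E\<inverse> `` {v} \<subseteq> R) \<and> peelable E (insert v R) vs"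

text \<open>The vertices return in reverse order of the list: when \<open>v\<close> comes back, all
  its out-neighbours or all its in-neighbours lie in the deleted set \<open>R\<close>, so it is a
  sink or a source of what is present.\<close>

lemma peelable_acyc:
  assumes "asym E" "peelable E R vs" "distinct vs" "set vs \<inter> R = {}" "T \<inter> (R \<union> set vs) = {}" "acyc E T"
  shows "acyc E (T \<union> set vs)"
  using assms(2-6)
proof (induction vs arbitrary: R)
  case Nil then show ?case by simp
next
  case (Cons v vs)
  have ac: "acyc E (T \<union> set vs)"
    by (rule Cons.IH[of "insert v R"]) (use Cons.prems in auto)
  have disj: "(T \<union> set vs) \<inter> R = {}" using Cons.prems by auto
  have "E `` {v} \<subseteq> R \<or> E\<inverse> `` {v} \<subseteq> R" using Cons.prems by simp
  then have "acyc E (insert v (T \<union> set vs))"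
  proof
    assume "E `` {v} \<subseteq> R"
    then show ?thesis using disj by (intro acyc_insert_sink[OF assms(1) ac]) blast
  next
    assume "E\<inverse> `` {v} \<subseteq> R"
    then show ?thesis using disj by (intro acyc_insert_source[OF assms(1) ac]) blast
  qed
  then show ?case by simp
qed

text \<open>The arcs inside \<open>X\<close>, their reversals and the diagonal are disjoint subsets
  of \<open>X \<times> X\<close>.\<close>

lemma card_Restr_asym:
  assumes "asym E" "finite X"
  shows "2 * card (Restr E X) + card X \<le> card X * card X"
proof -
  have fin: "finite (Restr E X)" using assms(2) by simp
  have "card (Restr E X \<union> (Restr E X)\<inverse>) = card (Restr E X) + card ((Restr E X)\<inverse>)"
    using fin asymD[OF assms(1)] by (intro card_Un_disjoint) auto
  moreover have "card ((Restr E X \<union> (Restr E X)\<inverse>) \<union> Id_on X) =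
      card (Restr E X \<union> (Restr E X)\<inverse>) + card (Id_on X)"
  proof (rule card_Un_disjoint)
    show "(Restr E X \<union> (Restr E X)\<inverse>) \<inter> Id_on X = {}" using asymD[OF assms(1)] by blast
  qed (use fin assms(2) in \<open>auto simp: Id_on_def\<close>)
  moreover have "card (Id_on X) = card X"
  proof -
    have "Id_on X = (\<lambda>x. (x, x)) ` X" by auto
    then show ?thesis by (simp add: card_image inj_on_def)
  qed
  moreover have "card ((Restr E X \<union> (Restr E X)\<inverse>) \<union> Id_on X) \<le> card (X \<times> X)"
    using assms(2) by (intro card_mono) auto
  ultimately show ?thesis by (simp add: card_cartesian_product)
qed

context min_cex
begin

lemma E_V: "(u, v) \<in> E \<Longrightarrow> u \<in> V \<and> v \<in> V"
  using E_sub by auto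

lemma card_meeting:
  assumes "X \<subseteq> V"
  shows "card (E - Restr E (V - X)) + card (Restr E X) = (\<Sum>v\<in>X. deg E v)"
proof -
  have "E - Restr E (V - X) = Restr E X \<union> links E X (V - X)"
    using E_sub by (auto simp: links_def)
  moreover have "card (Restr E X \<union> links E X (V - X)) = card (Restr E X) + card (links E X (V - X))"
    using fin_E by (intro card_Un_disjoint) (auto simp: links_def)
  ultimately show ?thesis using sum_deg[OF assms] by simp
qed

text \<open>The working form of the deletion inequality: \<open>S\<close> is kept, \<open>D\<close>
  is discarded, and the arcs meeting \<open>S \<union> D\<close> are expressed as degree sum minus
  inner arcs. Every later use needs an upper bound for the inner arcs.\<close>

lemma peel_reduction:
  assumes "distinct S" "set S \<inter> D = {}" "set S \<union> D \<subseteq> V" "S \<noteq> []" "peelable E D S"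
  shows "9 * length S + (\<Sum>v\<in>set S \<union> D. deg E v) < 7 * card (set S \<union> D) + card (Restr E (set S \<union> D))"
proof -
  have "9 * card (set S) + card (E - Restr E (V - (set S \<union> D))) < 7 * card (set S \<union> D)"
  proof (rule reduction)
    show "acyc E (T \<union> set S)" if "T \<subseteq> V - (set S \<union> D)" "acyc E T" for T
      using that by (intro peelable_acyc[OF asym assms(5,1,2)]) auto
  qed (use assms in auto)
  then show ?thesis using card_meeting[OF assms(3)] distinct_card[OF assms(1)] by simp
qed

section \<open>Possible in- and out-degrees\<close>

lemma outdeg_ne_0: "v \<in> V \<Longrightarrow> outdeg E v \<noteq> 0"
proof
  assume v: "v \<in> V" and "outdeg E v = 0"
  then have "E `` {v} = {}" using fin_E by (auto simp: outdeg_def finite_Image)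
  moreover have "Restr E {v} = {}" using no_loop by auto
  ultimately show False using peel_reduction[of "[v]" "{}"] v by simp
qed

lemma indeg_ne_0: "v \<in> V \<Longrightarrow> indeg E v \<noteq> 0"
  using min_cex.outdeg_ne_0[OF converse] by simp

lemma deg_ge_2: "v \<in> V \<Longrightarrow> deg E v \<ge> 2"
  using outdeg_ne_0[of v] indeg_ne_0[of v] by linarith

lemma outdeg_1D: "outdeg E v = 1 \<Longrightarrow> \<exists>u. E `` {v} = {u}"
  by (simp add: outdeg_def card_1_singleton_iff)

lemma indeg_1D: "indeg E v = 1 \<Longrightarrow> \<exists>u. E\<inverse> `` {v} = {u}"
  by (simp add: indeg_def card_1_singleton_iff)

lemma Restr_3: "distinct [a, b, c] \<Longrightarrow> card (Restr E {a, b, c}) \<le> 3"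
  using card_Restr_asym[OF asym, of "{a, b, c}"] by simp

text \<open>Minimum degree 2 gives at least 18 + 6 on the left, and three vertices span at most 3
  arcs, so the right is at most 21 + 3.\<close>

lemma three_peel_two:
  assumes "distinct [a, b, c]" "{a, b, c} \<subseteq> V" "peelable E {c} [a, b]"
  shows False
proof -
  have un: "set [a, b] \<union> {c} = {a, b, c}" by auto
  have "9 * length [a, b] + (\<Sum>v\<in>{a, b, c}. deg E v) < 7 * card {a, b, c} + card (Restr E {a, b, c})"
    unfolding un[symmetric] by (rule peel_reduction) (use assms in auto)
  moreover have "(\<Sum>v\<in>{a, b, c}. deg E v) = deg E a + deg E b + deg E c" using assms(1) by simp
  moreover have "card {a, b, c} = 3" using assms(1) by simp
  ultimately show False using Restr_3[of a b c] assms deg_ge_2[of a] deg_ge_2[of b] deg_ge_2[of c] by simp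
qed

lemma outdeg_ge_2:
  assumes v: "v \<in> V" shows "outdeg E v \<ge> 2"
proof (rule ccontr)
  assume "\<not> ?thesis"
  then have "outdeg E v = 1" using outdeg_ne_0[OF v] by linarith
  then obtain u where u: "E `` {v} = {u}" using outdeg_1D by blast
  then have vu: "(v, u) \<in> E" by auto
  have uV: "u \<in> V" and uv: "u \<noteq> v" using E_V[OF vu] vu no_loop by auto
  have "set [v] \<union> {u} = {v, u}" by auto
  then have "9 + (deg E v + deg E u) < 14 + card (Restr E {v, u})"
    using peel_reduction[of "[v]" "{u}"] u v uV uv by simp
  moreover have "card (Restr E {v, u}) \<le> 1"
    using card_Restr_asym[OF asym, of "{v, u}"] uv by simp
  ultimately have sum: "deg E v + deg E u \<le> 5" by linarith
  \<comment> \<open>If \<open>u\<close> has two out-neighbours, the sum 5 leaves exactly one in-arc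
    at each of \<open>u\<close> and \<open>v\<close>. Either way one further deleted vertex peels
    both of them.\<close>
  have "outdeg E u = 1 \<or> (indeg E u = 1 \<and> indeg E v = 1)"
    using sum outdeg_ne_0[OF v] indeg_ne_0[OF v] outdeg_ne_0[OF uV] indeg_ne_0[OF uV] by linarith
  then show False
  proof
    assume "outdeg E u = 1"
    then obtain x where x: "E `` {u} = {x}" using outdeg_1D by blast
    then have ux: "(u, x) \<in> E" by auto
    have "x \<noteq> u" "x \<noteq> v" using ux no_loop no_digon[OF vu] by auto
    then show False using three_peel_two[of u v x] E_V[OF ux] v uv u x by simp
  next
    assume 1: "indeg E u = 1 \<and> indeg E v = 1"
    then obtain x y where x: "E\<inverse> `` {v} = {x}" and y: "E\<inverse> `` {u} = {y}"
      using indeg_1D[of v] indeg_1D[of u] by auto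
    have "v \<in> E\<inverse> `` {u}" using vu by auto
    then have y: "E\<inverse> `` {u} = {v}" using y by simp
    have "x \<in> E\<inverse> `` {v}" using x by simp
    then have xv: "(x, v) \<in> E" by simp
    have "x \<noteq> u" "x \<noteq> v" using xv no_loop no_digon[OF vu] by auto
    then show False using three_peel_two[of v u x] E_V[OF xv] v uV uv x y by simp
  qed
qed

lemma indeg_ge_2: "v \<in> V \<Longrightarrow> indeg E v \<ge> 2"
  using min_cex.outdeg_ge_2[OF converse] by simp

lemma outdeg_2D:
  assumes "outdeg E v = 2"
  shows "\<exists>u w. E `` {v} = {u, w} \<and> u \<noteq> w"
  using assms unfolding outdeg_def card_2_iff by blast

text \<open>Deleting the two out-neighbours of \<open>b\<close> peels \<open>b\<close> and then
  \<open>a\<close>. With all degrees at least 4 this gives 18 + 16 against at most 28 + 6.\<close>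

lemma transitive_triple_outdeg:
  assumes "E `` {a} = {b, c}" "(b, c) \<in> E" "deg E a \<ge> 4"
  shows "outdeg E b \<noteq> 2"
proof
  assume "outdeg E b = 2"
  then obtain y where y: "E `` {b} = {c, y}" "y \<noteq> c"
    using outdeg_2D[of b] assms(2) by (metis Image_singleton_iff empty_iff insert_iff insert_commute)
  have arcs: "(a, b) \<in> E" "(a, c) \<in> E" "(b, y) \<in> E" using assms(1) y(1) by auto
  have V: "{a, b, c, y} \<subseteq> V" using arcs E_V by auto
  have dist: "distinct [a, b, c, y]"
    using arcs assms(2) y(2) no_loop no_digon by auto
  have un: "set [b, a] \<union> {c, y} = {a, b, c, y}" by auto
  have "9 * length [b, a] + (\<Sum>v\<in>{a, b, c, y}. deg E v) < 7 * card {a, b, c, y} + card (Restr E {a, b, c, y})"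
    unfolding un[symmetric] by (rule peel_reduction) (use V dist y(1) assms(1) in auto)
  moreover have "(\<Sum>v\<in>{a, b, c, y}. deg E v) = deg E a + deg E b + deg E c + deg E y" "card {a, b, c, y} = 4"
    using dist by simp_all
  moreover have "card (Restr E {a, b, c, y}) \<le> 6"
    using card_Restr_asym[OF asym, of "{a, b, c, y}"] dist by simp
  moreover have "deg E b \<ge> 4" "deg E c \<ge> 4" "deg E y \<ge> 4"
    using V indeg_ge_2[of b] outdeg_ge_2[of b] indeg_ge_2[of c] outdeg_ge_2[of c] indeg_ge_2[of y] outdeg_ge_2[of y]
    by simp_all
  ultimately show False using assms(3) by simp
qed

text \<open>Keeping \<open>v\<close> and deleting its out-neighbours forces both of these to have
  degree 4 and to be adjacent, which is the transitive triple just excluded.\<close>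

lemma not_in4_out2:
  assumes v: "v \<in> V" "indeg E v = 4" "outdeg E v = 2"
  shows False
proof -
  obtain u w where uw: "E `` {v} = {u, w}" "u \<noteq> w" using outdeg_2D[OF v(3)] by blast
  have arcs: "(v, u) \<in> E" "(v, w) \<in> E" using uw by auto
  have V: "{v, u, w} \<subseteq> V" using arcs E_V by auto
  have dist: "distinct [v, u, w]" using arcs uw(2) no_loop by auto
  have ge: "indeg E u \<ge> 2" "outdeg E u \<ge> 2" "indeg E w \<ge> 2" "outdeg E w \<ge> 2"
    using V indeg_ge_2 outdeg_ge_2 by auto
  have un: "set [v] \<union> {u, w} = {v, u, w}" by auto
  have "9 * length [v] + (\<Sum>x\<in>{v, u, w}. deg E x) < 7 * card {v, u, w} + card (Restr E {v, u, w})"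
    unfolding un[symmetric] by (rule peel_reduction) (use V dist uw(1) in auto)
  moreover have "(\<Sum>x\<in>{v, u, w}. deg E x) = deg E v + deg E u + deg E w" "card {v, u, w} = 3"
    using dist by simp_all
  ultimately have less: "deg E u + deg E w < 6 + card (Restr E {v, u, w})" using v by simp
  have out2: "outdeg E u = 2" "outdeg E w = 2"
  proof -
    have "card (Restr E {v, u, w}) \<le> 3" using dist by (intro Restr_3) simp_all
    then show "outdeg E u = 2" "outdeg E w = 2" using less ge by linarith+
  qed
  have "(u, w) \<in> E \<or> (w, u) \<in> E"
  proof (rule ccontr)
    assume "\<not> ?thesis"
    then have "Restr E {v, u, w} \<subseteq> {(v, u), (v, w)}" using no_loop no_digon arcs by auto
    then have "card (Restr E {v, u, w}) \<le> card {(v, u), (v, w)}" by (intro card_mono) auto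
    then have "card (Restr E {v, u, w}) \<le> 2" by (simp add: card_insert_if split: if_splits)
    then show False using less ge by linarith
  qed
  then show False
    using transitive_triple_outdeg[of v u w] transitive_triple_outdeg[of v w u] uw(1) v out2
    by (auto simp: insert_commute)
qed

lemma vertex_types:
  assumes v: "v \<in> V"
  shows "(indeg E v, outdeg E v) \<in> {(2, 2), (2, 3), (3, 2), (3, 3)}"
proof -
  have "\<not> (indeg E v = 4 \<and> outdeg E v = 2)" "\<not> (indeg E v = 2 \<and> outdeg E v = 4)"
    using not_in4_out2[OF v] min_cex.not_in4_out2[OF converse v] by auto
  then have "(indeg E v = 2 \<or> indeg E v = 3) \<and> (outdeg E v = 2 \<or> outdeg E v = 3)"
    using outdeg_ge_2[OF v] indeg_ge_2[OF v] deg_le_6[OF v] by presburger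
  then show ?thesis by auto
qed

text \<open>Otherwise delete \<open>w\<close> and contract \<open>v \<rightarrow> u\<close>. The only loss is that the contracted vertex may
  lie in a new member \<open>K\<close> of the family, and then an acyclic set of \<open>K\<close> that avoids \<open>u\<close> and the
  out-neighbours of \<open>w\<close> can be extended by \<open>v\<close>.\<close>

lemma out_pair_triangle:
  assumes vE: "E `` {v} = {u, w}" and uw: "u \<noteq> w"
  shows "\<exists>x. (u, x) \<in> E \<and> (x, v) \<in> E"
proof (rule ccontr)
  assume no_tri: "\<not> ?thesis"
  have vu: "(v, u) \<in> E" and vw: "(v, w) \<in> E" using vE by auto
  have V: "v \<in> V" "u \<in> V" "w \<in> V" using E_V vu vw by auto
  have ne: "v \<noteq> u" "v \<noteq> w" using vu vw no_loop by auto
  define V' where "V' = V - {v, w}"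
  \<comment> \<open>Arcs into \<open>v\<close> are redirected to \<open>u\<close>. No out-arc of
    \<open>v\<close> has to be moved, since after the deletion of \<open>w\<close> only the
    contracted one remains.\<close>
  define E' where "E' = Restr E V' \<union> {(x, u) |x. (x, v) \<in> E}"
  have uV': "u \<in> V'" using V ne uw by (auto simp: V'_def)
  have in_v: "x \<in> V'" "x \<noteq> u" if "(x, v) \<in> E" for x
    using that E_V[OF that] no_loop no_digon[OF vw] no_digon[OF vu] by (auto simp: V'_def)
  have E'_sub: "E' \<subseteq> V' \<times> V'" using in_v uV' by (auto simp: E'_def)
  have E'_iff: "(x, y) \<in> E' \<longleftrightarrow> x \<in> V' \<and> y \<in> V' \<and> (x, y) \<in> E \<or> (x, v) \<in> E \<and> y = u" for x y
    by (auto simp: E'_def)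
  \<comment> \<open>A new digon at \<open>u\<close> would consist of a redirected arc from some
    \<open>x\<close> and an arc from \<open>u\<close> to \<open>x\<close>, which is a directed
    triangle through \<open>v\<close>.\<close>
  have asym': "asym E'"
  proof (rule asymI)
    fix x y assume "(x, y) \<in> E'"
    then show "(y, x) \<notin> E'" using no_digon no_tri in_v unfolding E'_iff by blast
  qed
  have fins: "finite V'" "card V' = card V - 2" "card V \<ge> 2"
    using fin V ne(2) card_mono[of V "{v, w}"] by (auto simp: V'_def card_Diff_subset)
  then have "bound E' V'" using minimal[of V' E'] asym' by simp
  then obtain T where T: "T \<subseteq> V'" "acyc E' T"
      "7 * card V' \<le> 9 * card T + card (Restr E' V') + card (paley_parts E' V')"
    unfolding bound_def by blast
  have acT: "acyc E (insert v T)"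
  proof (cases "u \<in> T")
    case False
    have "Restr E T \<subseteq> Restr E' T" using T(1) unfolding E'_def by blast
    then have "acyc E T" using T(2) acyclic_subset unfolding acyc_def by blast
    moreover have "w \<notin> T" using T(1) by (auto simp: V'_def)
    ultimately show ?thesis using False vE by (intro acyc_insert_sink[OF asym]) auto
  next
    case True
    \<comment> \<open>Contraction maps walks to walks and loses only the arc from \<open>v\<close>
      to \<open>u\<close>. A walk can vanish only if it is that single arc, so a closed walk stays
      nonempty.\<close>
    let ?f = "\<lambda>x. if x = v then u else x"
    let ?R = "Restr E (insert v T)" and ?R' = "Restr E' T"
    have TV: "x \<in> V'" if "x \<in> T" for x using T(1) that by blast
    have vT: "v \<notin> T" "w \<notin> T" using T(1) by (auto simp: V'_def)
    have step: "(?f a, ?f b) \<in> ?R' \<or> a = v \<and> b = u" if "(a, b) \<in> ?R" for a b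
    proof (cases "a = v")
      case True
      then have "b \<in> {u, w}" using that vE by auto
      then show ?thesis using that True vT ne by auto
    next
      case False
      then have "a \<in> T" "(a, b) \<in> E" "b = v \<or> b \<in> T" using that by auto
      then show ?thesis using False TV \<open>u \<in> T\<close> by (auto simp: E'_iff)
    qed
    have path: "(?f a, ?f b) \<in> ?R'\<^sup>+ \<or> a = v \<and> b = u" if "(a, b) \<in> ?R\<^sup>+" for a b
      using that
    proof (induction rule: trancl_induct)
      case (base b) then show ?case using step[of a b] by blast
    next
      case (step b c)
      note s = \<open>\<And>a b. (a, b) \<in> ?R \<Longrightarrow> (?f a, ?f b) \<in> ?R' \<or> a = v \<and> b = u\<close>
      show ?case using step(3)
      proof
        assume ab: "(?f a, ?f b) \<in> ?R'\<^sup>+"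
        show ?thesis using s[OF step(2)]
        proof
          assume "(?f b, ?f c) \<in> ?R'"
          with ab show ?thesis by (meson trancl.trancl_into_trancl)
        next
          assume "b = v \<and> c = u"
          with ab ne show ?thesis by auto
        qed
      next
        assume ab: "a = v \<and> b = u"
        then have "(?f b, ?f c) \<in> ?R'" using s[OF step(2)] ne by blast
        then show ?thesis using ab ne by auto
      qed
    qed
    have False if "(y, y) \<in> ?R\<^sup>+" for y
      using path[OF that] T(2) ne unfolding acyc_def acyclic_def by blast
    then show ?thesis by (auto simp: acyc_def acyclic_def)
  qed
  have parts0: "paley_parts E V = {}" by (rule no_parts) simp
  have vT: "v \<notin> T" "finite T" using T(1) fins(1) finite_subset by (auto simp: V'_def)
  have A1: "9 * card T + 9 + card E < 7 * card V"
  proof -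
    have "insert v T \<subseteq> V" using T(1) V by (auto simp: V'_def)
    then show ?thesis using too_few[OF _ acT] vT parts0 by simp
  qed
  have A2: "card (Restr E' V') \<le> card (Restr E V') + indeg E v"
  proof -
    have "{(x, u) |x. (x, v) \<in> E} = (\<lambda>x. (x, u)) ` (E\<inverse> `` {v})" by auto
    then have "card {(x, u) |x. (x, v) \<in> E} = indeg E v" by (simp add: indeg_def card_image inj_on_def)
    moreover have "Restr E' V' = Restr E V' \<union> {(x, u) |x. (x, v) \<in> E}"
      using E'_sub by (auto simp: E'_def)
    ultimately show ?thesis using card_Un_le[of "Restr E V'" "{(x, u) |x. (x, v) \<in> E}"] by simp
  qed
  have outv: "outdeg E v = 2" using vE uw by (simp add: outdeg_def)
  have A3: "card E + card (Restr E {v, w}) = card (Restr E V') + indeg E v + 2 + deg E w"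
  proof -
    have "card E = card (Restr E V') + card (E - Restr E V')"
      using fin_E by (simp add: card_Diff_subset card_mono)
    moreover have "card (E - Restr E (V - {v, w})) + card (Restr E {v, w}) = (\<Sum>v\<in>{v, w}. deg E v)"
      using V by (intro card_meeting) auto
    ultimately show ?thesis using ne outv by (simp add: V'_def)
  qed
  have A4: "card (Restr E {v, w}) \<le> 1"
    using card_Restr_asym[OF asym, of "{v, w}"] ne by simp
  \<comment> \<open>Two vertices are lost (14), \<open>v\<close> is regained (9), and at least deg w
    + 1 arcs disappear, so deg w + 1 is below 5 plus the number of parts.\<close>
  have degw: "deg E w < 4 + card (paley_parts E' V')"
    using A1 A2 A3 A4 T(3) fins(2,3) by linarith
  have contains_u: "u \<in> K" if K: "K \<in> paley_parts E' V'" for K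
  proof (rule ccontr)
    assume "u \<notin> K"
    have KV': "paley_set E' K" "K \<subseteq> V'" using K by (simp_all add: paley_parts_def)
    have "(x, y) \<in> E' \<longleftrightarrow> (x, y) \<in> E" if "x \<in> K" "y \<in> K" for x y
      using that KV'(2) \<open>u \<notin> K\<close> unfolding E'_iff by blast
    then have "paley_set E K" by (rule paley_set_cong[OF KV'(1)])
    moreover have "K \<subseteq> V" using KV'(2) unfolding V'_def by blast
    ultimately show False using no_paley by blast
  qed
  have "K = L" if "K \<in> paley_parts E' V'" "L \<in> paley_parts E' V'" for K L
    using paley_parts_disjoint[OF asym' that] contains_u[OF that(1)] contains_u[OF that(2)] by blast
  then have "paley_parts E' V' = {} \<or> (\<exists>K. paley_parts E' V' = {K})" by blast
  moreover have ge: "indeg E w \<ge> 2" "outdeg E w \<ge> 2" using indeg_ge_2 outdeg_ge_2 V by auto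
  moreover have "paley_parts E' V' \<noteq> {}" using degw ge by (intro notI) simp
  ultimately obtain K where K: "paley_parts E' V' = {K}" by blast
  then have outw: "outdeg E w = 2" using degw ge by simp
  have Kin: "K \<in> paley_parts E' V'" using K by simp
  have uK: "u \<in> K" using contains_u[OF Kin] .
  have Kp: "paley_set E' K" "K \<subseteq> V'" "links E' K (V' - K) = {}" using Kin by (auto simp: paley_parts_def)
  have finK: "finite K" using Kp(2) fins(1) finite_subset by blast
  obtain t where t: "card K = 7 * t" "card (Restr E' K) + 1 = 22 * t"
     "\<forall>B. finite B \<longrightarrow> card B \<le> 3 \<longrightarrow> (\<exists>S \<subseteq> K - B. acyc E' S \<and> card S = 3 * t)"
    using paley_set_props[OF Kp(1) asym'] by blast
  have finw: "finite (insert u (E `` {w}))" using fin_E by (simp add: finite_Image)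
  \<comment> \<open>The remaining case has \<open>w\<close> of out-degree 2, so the forbidden
    vertices number at most three, just what \<open>paley_set_props\<close> tolerates.\<close>
  have "card (insert u (E `` {w})) \<le> 3"
    using outw card_insert_le_m1[of 3 "E `` {w}" u] by (simp add: outdeg_def)
  then obtain S where S: "S \<subseteq> K - insert u (E `` {w})" "acyc E' S" "card S = 3 * t"
    using t(3)[rule_format, OF finw] by blast
  have SE: "acyc E S"
  proof -
    have "Restr E S \<subseteq> Restr E' S" using S(1) Kp(2) unfolding E'_def by blast
    then show ?thesis using S(2) acyclic_subset unfolding acyc_def by blast
  qed
  have wvS: "v \<notin> S" "w \<notin> S" "u \<notin> S" "v \<notin> K" "w \<notin> K" using S(1) Kp(2) by (auto simp: V'_def)
  have acS: "acyc E (insert v S)"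
    using SE vE wvS by (intro acyc_insert_sink[OF asym]) auto
  \<comment> \<open>No outside vertex points into \<open>S\<close> or \<open>v\<close>: from a
    vertex other than \<open>w\<close> such an arc would be a link of \<open>K\<close> in the
    contracted graph, and \<open>w\<close> is excluded by the choice of \<open>S\<close> and by the
    absence of digons.\<close>
  have "9 * card (insert v S) + card (E - Restr E (V - insert v K)) < 7 * card (insert v K)"
  proof (rule reduction)
    show "insert v K \<subseteq> V" "insert v K \<noteq> {}" "insert v S \<subseteq> insert v K"
      using V Kp(2) S(1) by (auto simp: V'_def)
    show "acyc E (T \<union> insert v S)" if T: "T \<subseteq> V - insert v K" "acyc E T" for T
    proof -
      have "E \<inter> T \<times> insert v S = {}"
      proof (rule ccontr)
        assume "E \<inter> T \<times> insert v S \<noteq> {}"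
        then obtain a b where ab: "(a, b) \<in> E" "a \<in> T" "b = v \<or> b \<in> S" by auto
        have aK: "a \<notin> K" "a \<noteq> v" using ab(2) T(1) by auto
        show False
        proof (cases "a = w")
          case True
          then show False using ab S(1) no_digon[OF vw] by auto
        next
          case False
          then have "a \<in> V'" using aK ab(2) T(1) by (auto simp: V'_def)
          moreover have "b \<in> K" if "b \<noteq> v" using that ab(3) S(1) by auto
          ultimately have "(a, u) \<in> E' \<or> (a, b) \<in> E' \<and> b \<in> K"
            using ab(1) Kp(2) unfolding E'_iff by blast
          then have "links E' K (V' - K) \<noteq> {}"
            using uK aK \<open>a \<in> V'\<close> unfolding links_def by blast
          then show False using Kp(3) by simp
        qed
      qed
      then show ?thesis using acyc_Un[OF acS T(2)] by (simp add: Un_commute)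
    qed
  qed
  moreover have "card (insert v S) = 3 * t + 1" "card (insert v K) = 7 * t + 1"
    using wvS S(3) t(1) finK finite_subset[OF S(1)] by simp_all
  \<comment> \<open>Each redirected arc comes from an arc into \<open>v\<close>, so the 22t - 1 arcs
    of the contracted member are matched by original ones; the two out-arcs of \<open>v\<close> are
    additional. Then 9(3t + 1) + 22t + 1 exceeds 7(7t + 1).\<close>
  moreover have "22 * t + 1 \<le> card (E - Restr E (V - insert v K))"
  proof -
    have KV: "K \<subseteq> V" using Kp(2) by (auto simp: V'_def)
    let ?I = "(\<lambda>x. (x, v)) ` (E\<inverse> `` {v})"
    have "Restr E' K \<subseteq> Restr E K \<union> (\<lambda>x. (x, u)) ` (E\<inverse> `` {v})" by (auto simp: E'_iff)
    then have "card (Restr E' K) \<le> card (Restr E K \<union> (\<lambda>x. (x, u)) ` (E\<inverse> `` {v}))"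
      using fin_E by (intro card_mono) (auto intro!: finite_imageI finite_Image)
    also have "\<dots> \<le> card (Restr E K) + card ((\<lambda>x. (x, u)) ` (E\<inverse> `` {v}))" by (rule card_Un_le)
    also have "card ((\<lambda>x. (x, u)) ` (E\<inverse> `` {v})) = card ?I" by (simp add: card_image inj_on_def)
    finally have le: "card (Restr E' K) \<le> card (Restr E K) + card ?I" .
    have finI: "finite ?I" using fin_E by (intro finite_imageI finite_Image) simp
    have "card (Restr E K \<union> ?I \<union> {(v, u), (v, w)}) = card (Restr E K) + card ?I + 2"
    proof -
      have "card (Restr E K \<union> ?I) = card (Restr E K) + card ?I"
        using fin_E finI wvS by (intro card_Un_disjoint) auto
      moreover have "card (Restr E K \<union> ?I \<union> {(v, u), (v, w)}) =
          card (Restr E K \<union> ?I) + card {(v, u), (v, w)}"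
        using fin_E finI wvS no_loop ne by (intro card_Un_disjoint) auto
      ultimately show ?thesis using uw by simp
    qed
    moreover have "Restr E K \<union> ?I \<union> {(v, u), (v, w)} \<subseteq> E - Restr E (V - insert v K)"
      using vu vw uK by auto
    then have "card (Restr E K \<union> ?I \<union> {(v, u), (v, w)}) \<le> card (E - Restr E (V - insert v K))"
      using fin_E by (intro card_mono) auto
    ultimately show ?thesis using le t(2) by linarith
  qed
  ultimately show False by simp
qed

lemma poor_arc_triangle:
  assumes ab: "(a, b) \<in> E" and "outdeg E a = 2 \<or> indeg E b = 2"
  shows "\<exists>x. (b, x) \<in> E \<and> (x, a) \<in> E"
proof -
  have out: "\<exists>x. (b, x) \<in> F \<and> (x, a) \<in> F" if F: "min_cex V F" "(a, b) \<in> F" "outdeg F a = 2" for F a b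
  proof -
    obtain u w where "F `` {a} = {u, w}" "u \<noteq> w" using min_cex.outdeg_2D[OF F(1,3)] by blast
    then show ?thesis
      using min_cex.out_pair_triangle[OF F(1), of a u w] min_cex.out_pair_triangle[OF F(1), of a w u] F(2)
      by (auto simp: insert_commute)
  qed
  show ?thesis
  proof (cases "outdeg E a = 2")
    case True
    then show ?thesis using out[OF _ ab] by (simp add: min_cex_axioms)
  next
    case False
    then show ?thesis using out[OF converse, of b a] assms by auto
  qed
qed

end

section \<open>Checking local case distinctions\<close>

text \<open>A state describes distinct vertices \<open>0, 1, \<dots>\<close> by their (in-degree, out-degree) pairs, some
  arcs and some ordered pairs that are not arcs; nothing is known about the other pairs.\<close>

type_synonym state = "(nat \<times> nat) list \<times> (nat \<times> nat) list \<times> (nat \<times> nat) list"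

text \<open>\<open>Win S D\<close> applies the deletion inequality to \<open>X = S \<union> D\<close>, and \<open>Emb k g\<close> finds the \<open>k\<close>-th
  excluded state via \<open>g\<close>. \<open>Out v\<close> and \<open>In v\<close> branch over an unknown neighbour of \<open>v\<close>, \<open>Tri a b\<close> over
  the third vertex of a directed triangle through the arc \<open>a \<rightarrow> b\<close>, and \<open>Split a b\<close> over whether
  \<open>a \<rightarrow> b\<close> is an arc.\<close>

datatype cert =
    Win "nat list" "nat list"
  | Emb nat "nat list"
  | Out nat "cert list"
  | In nat "cert list"
  | Tri nat nat "cert list"
  | Split nat nat cert cert

definition outs :: "(nat \<times> nat) list \<Rightarrow> nat \<Rightarrow> nat list" where
  "outs A v = map snd (filter (\<lambda>p. fst p = v) A)"

definition ins :: "(nat \<times> nat) list \<Rightarrow> nat \<Rightarrow> nat list" where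
  "ins A v = map fst (filter (\<lambda>p. snd p = v) A)"

fun free_out :: "state \<Rightarrow> nat \<Rightarrow> nat" where
  "free_out (ts, A, N) v = snd (ts ! v) - length (outs A v)"

fun free_in :: "state \<Rightarrow> nat \<Rightarrow> nat" where
  "free_in (ts, A, N) v = fst (ts ! v) - length (ins A v)"

text \<open>A vertex whose prescribed degree is used up admits no further arc, so many pairs are
  decided without an entry in \<open>N\<close>.\<close>

fun possible :: "state \<Rightarrow> nat \<Rightarrow> nat \<Rightarrow> bool" where
  "possible (ts, A, N) a b \<longleftrightarrow>
     a \<noteq> b \<and> (a, b) \<notin> set A \<and> (b, a) \<notin> set A \<and> (a, b) \<notin> set N \<and>
     free_out (ts, A, N) a \<noteq> 0 \<and> free_in (ts, A, N) b \<noteq> 0"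

text \<open>\<open>List.insert\<close> is needed because closing a triangle may re-add a known arc,
  while degree counting relies on a list without repetitions.\<close>

fun add_arc :: "nat \<Rightarrow> nat \<Rightarrow> state \<Rightarrow> state" where
  "add_arc a b (ts, A, N) = (ts, List.insert (a, b) A, N)"

fun add_nonarc :: "nat \<Rightarrow> nat \<Rightarrow> state \<Rightarrow> state" where
  "add_nonarc a b (ts, A, N) = (ts, A, (a, b) # N)"

fun add_vertex :: "nat \<times> nat \<Rightarrow> state \<Rightarrow> state" where
  "add_vertex t (ts, A, N) = (ts @ [t], A, N)"

definition size_of :: "state \<Rightarrow> nat" where
  "size_of st = length (fst st)"

text \<open>Branches over the first \<open>w\<close> for which \<open>arc w\<close> is present; \<open>k\<close> handles the case that none is.\<close>

primrec split_arcs :: "(nat \<Rightarrow> nat \<times> nat) \<Rightarrow> (state \<Rightarrow> state list) \<Rightarrow> nat list \<Rightarrow> state \<Rightarrow> state list" where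
  "split_arcs arc k [] st = k st"
| "split_arcs arc k (w # ws) st =
     add_arc (fst (arc w)) (snd (arc w)) st #
     split_arcs arc k ws (add_nonarc (fst (arc w)) (snd (arc w)) st)"

definition out_cases :: "(nat \<times> nat) list \<Rightarrow> nat \<Rightarrow> state \<Rightarrow> state list" where
  "out_cases T v st = split_arcs (\<lambda>w. (v, w))
     (\<lambda>s. map (\<lambda>t. add_arc v (size_of s) (add_vertex t s)) T)
     (filter (possible st v) [0..<size_of st]) st"

definition in_cases :: "(nat \<times> nat) list \<Rightarrow> nat \<Rightarrow> state \<Rightarrow> state list" where
  "in_cases T v st = split_arcs (\<lambda>w. (w, v))
     (\<lambda>s. map (\<lambda>t. add_arc (size_of s) v (add_vertex t s)) T)
     (filter (\<lambda>w. possible st w v) [0..<size_of st]) st"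

fun maybe_arc :: "state \<Rightarrow> nat \<Rightarrow> nat \<Rightarrow> bool" where
  "maybe_arc (ts, A, N) a b \<longleftrightarrow> (a, b) \<in> set A \<or> possible (ts, A, N) a b"

text \<open>The third vertex may use arcs that are already known, hence \<open>maybe_arc\<close>; a
  fresh vertex needs a free slot at both ends. An empty list of cases refutes the state
  outright.\<close>

definition tri_cases :: "(nat \<times> nat) list \<Rightarrow> nat \<Rightarrow> nat \<Rightarrow> state \<Rightarrow> state list" where
  "tri_cases T a b st =
     map (\<lambda>y. add_arc y a (add_arc b y st))
       (filter (\<lambda>y. maybe_arc st b y \<and> maybe_arc st y a) [0..<size_of st]) @
     (if free_out st b \<noteq> 0 \<and> free_in st a \<noteq> 0
      then map (\<lambda>t. add_arc (size_of st) a (add_arc b (size_of st) (add_vertex t st))) T else [])"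

fun peels :: "state \<Rightarrow> nat list \<Rightarrow> nat list \<Rightarrow> bool" where
  "peels st R [] \<longleftrightarrow> True"
| "peels (ts, A, N) R (v # vs) \<longleftrightarrow>
     (free_out (ts, A, N) v = 0 \<and> set (outs A v) \<subseteq> set R \<or>
      free_in (ts, A, N) v = 0 \<and> set (ins A v) \<subseteq> set R) \<and> peels (ts, A, N) (v # R) vs"

text \<open>An upper bound for the number of arcs from \<open>v\<close> into \<open>X\<close>: the known ones, and as many of the
  undecided ones as \<open>v\<close> has unknown out-neighbours.\<close>

fun inner_bound :: "state \<Rightarrow> nat list \<Rightarrow> nat \<Rightarrow> nat" where
  "inner_bound (ts, A, N) X v =
     length (filter (\<lambda>w. w \<in> set X) (outs A v)) +
     (let k = free_out (ts, A, N) v in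
      if k = 0 then 0 else min k (length (filter (possible (ts, A, N) v) X)))"

text \<open>The negation of the conclusion of \<open>peel_reduction\<close>, with exact degrees and
  with the inner arcs replaced by an upper bound.\<close>

fun wins :: "state \<Rightarrow> nat list \<Rightarrow> nat list \<Rightarrow> bool" where
  "wins (ts, A, N) S D \<longleftrightarrow> S \<noteq> [] \<and>
     distinct (S @ D) \<and> (\<forall>v \<in> set (S @ D). v < length ts) \<and> peels (ts, A, N) D S \<and>
     7 * length (S @ D) + sum_list (map (inner_bound (ts, A, N) (S @ D)) (S @ D)) \<le>
     9 * length S + sum_list (map (\<lambda>v. fst (ts ! v) + snd (ts ! v)) (S @ D))"

fun embeds :: "state \<Rightarrow> state \<Rightarrow> nat list \<Rightarrow> bool" where
  "embeds (ts', A', N') (ts, A, N) g \<longleftrightarrow>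
     distinct g \<and> (\<forall>x \<in> set g. x < length ts) \<and> map ((!) ts) g = ts' \<and> distinct A' \<and> N' = [] \<and>
     (\<forall>p \<in> set A'. fst p < length g \<and> snd p < length g \<and> (g ! fst p, g ! snd p) \<in> set A)"

text \<open>\<open>F\<close> holds the states excluded before and \<open>T\<close> the admissible
  vertex types. The value is a predicate on states so that the recursion can pass through
  \<open>map\<close> over subtrees; \<open>list_all2\<close> also enforces that every case has its
  own subtree.\<close>

primrec check :: "state list \<Rightarrow> (nat \<times> nat) list \<Rightarrow> cert \<Rightarrow> state \<Rightarrow> bool" where
  "check F T (Win S D) = (\<lambda>st. wins st S D)"
| "check F T (Emb k g) = (\<lambda>st. k < length F \<and> embeds (F ! k) st g)"
| "check F T (Out v cs) = (\<lambda>st. v < size_of st \<and> free_out st v \<noteq> 0 \<and>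
     list_all2 (\<lambda>s p. p s) (out_cases T v st) (map (check F T) cs))"
| "check F T (In v cs) = (\<lambda>st. v < size_of st \<and> free_in st v \<noteq> 0 \<and>
     list_all2 (\<lambda>s p. p s) (in_cases T v st) (map (check F T) cs))"
| "check F T (Tri a b cs) = (\<lambda>st. (a, b) \<in> set (fst (snd st)) \<and>
     (snd (fst st ! a) = 2 \<or> fst (fst st ! b) = 2) \<and>
     list_all2 (\<lambda>s p. p s) (tri_cases T a b st) (map (check F T) cs))"
| "check F T (Split a b c d) = (\<lambda>st. a < size_of st \<and> b < size_of st \<and>
     check F T c (add_arc a b st) \<and> check F T d (add_nonarc a b st))"

text \<open>Distinctness of \<open>A\<close> makes list lengths equal to numbers of known
  neighbours, so \<open>free_out\<close> and \<open>free_in\<close> count the unknown ones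
  exactly.\<close>

fun realizes :: "('a \<times> 'a) set \<Rightarrow> 'a set \<Rightarrow> (nat \<Rightarrow> 'a) \<Rightarrow> state \<Rightarrow> bool" where
  "realizes E V f (ts, A, N) \<longleftrightarrow>
     inj_on f {..<length ts} \<and> distinct A \<and>
     (\<forall>i<length ts. f i \<in> V \<and> indeg E (f i) = fst (ts ! i) \<and> outdeg E (f i) = snd (ts ! i)) \<and>
     (\<forall>p\<in>set A. fst p < length ts \<and> snd p < length ts \<and> (f (fst p), f (snd p)) \<in> E) \<and>
     (\<forall>p\<in>set N. fst p < length ts \<and> snd p < length ts \<and> (f (fst p), f (snd p)) \<notin> E)"

definition realizable :: "('a \<times> 'a) set \<Rightarrow> 'a set \<Rightarrow> state \<Rightarrow> bool" where
  "realizable E V st \<longleftrightarrow> (\<exists>f. realizes E V f st)"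

section \<open>Soundness of the checker\<close>

lemma set_outs: "set (outs A v) = {w. (v, w) \<in> set A}"
  by (force simp: outs_def)

lemma set_ins: "set (ins A v) = {w. (w, v) \<in> set A}"
  by (force simp: ins_def)

lemma distinct_outs: "distinct A \<Longrightarrow> distinct (outs A v)"
  by (auto simp: outs_def distinct_map inj_on_def)

lemma distinct_ins: "distinct A \<Longrightarrow> distinct (ins A v)"
  by (auto simp: ins_def distinct_map inj_on_def)

lemma realizes_add_arc:
  assumes "realizes E V f st" "a < size_of st" "b < size_of st" "(f a, f b) \<in> E"
  shows "realizes E V f (add_arc a b st)"
  using assms by (cases st) (auto simp: size_of_def)

lemma realizes_add_nonarc:
  assumes "realizes E V f st" "a < size_of st" "b < size_of st" "(f a, f b) \<notin> E"
  shows "realizes E V f (add_nonarc a b st)"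
  using assms by (cases st) (auto simp: size_of_def)

lemma realizes_add_vertex:
  assumes "realizes E V f st" "x \<in> V" "x \<notin> f ` {..<size_of st}"
  shows "realizes E V (f(size_of st := x)) (add_vertex (indeg E x, outdeg E x) st)"
proof -
  obtain ts A N where st: "st = (ts, A, N)" by (cases st)
  have "inj_on (f(length ts := x)) {..<length ts}"
    using assms(1) unfolding st by (auto simp: inj_on_def)
  moreover have "{..<Suc (length ts)} = insert (length ts) {..<length ts}" by auto
  ultimately have "inj_on (f(length ts := x)) {..<Suc (length ts)}"
    using assms(3) unfolding st size_of_def by (auto simp: inj_on_def)
  then show ?thesis using assms(1,2) unfolding st
    by (auto simp: size_of_def nth_append less_Suc_eq)
qed

context min_cex
begin

lemma known_out:
  assumes "realizes E V f (ts, A, N)" "v < length ts"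
  shows "f ` set (outs A v) \<subseteq> E `` {f v}" "card (f ` set (outs A v)) = length (outs A v)"
    "free_out (ts, A, N) v = card (E `` {f v} - f ` set (outs A v))"
proof -
  show 1: "f ` set (outs A v) \<subseteq> E `` {f v}" using assms by (auto simp: set_outs)
  have "set (outs A v) \<subseteq> {..<length ts}" using assms by (auto simp: set_outs)
  then have "inj_on f (set (outs A v))" using assms by (auto intro: inj_on_subset)
  then show 2: "card (f ` set (outs A v)) = length (outs A v)"
    using assms distinct_outs[of A v] by (simp add: card_image distinct_card)
  show "free_out (ts, A, N) v = card (E `` {f v} - f ` set (outs A v))"
    using assms 1 2 by (simp add: card_Diff_subset outdeg_def)
qed

lemma known_in:
  assumes "realizes E V f (ts, A, N)" "v < length ts"
  shows "f ` set (ins A v) \<subseteq> E\<inverse> `` {f v}" "card (f ` set (ins A v)) = length (ins A v)"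
    "free_in (ts, A, N) v = card (E\<inverse> `` {f v} - f ` set (ins A v))"
proof -
  show 1: "f ` set (ins A v) \<subseteq> E\<inverse> `` {f v}" using assms by (auto simp: set_ins)
  have "set (ins A v) \<subseteq> {..<length ts}" using assms by (auto simp: set_ins)
  then have "inj_on f (set (ins A v))" using assms by (auto intro: inj_on_subset)
  then show 2: "card (f ` set (ins A v)) = length (ins A v)"
    using assms distinct_ins[of A v] by (simp add: card_image distinct_card)
  show "free_in (ts, A, N) v = card (E\<inverse> `` {f v} - f ` set (ins A v))"
    using assms 1 2 by (simp add: card_Diff_subset indeg_def)
qed

lemma finite_out: "finite (E `` {x})" and finite_in: "finite (E\<inverse> `` {x})"
  using fin_E by (simp_all add: finite_Image)

lemma free_out_ne_0:
  assumes "realizes E V f (ts, A, N)" "v < length ts" "(f v, x) \<in> E" "x \<notin> f ` set (outs A v)"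
  shows "free_out (ts, A, N) v \<noteq> 0"
  unfolding known_out(3)[OF assms(1,2)] using assms(3,4) finite_out[of "f v"] by auto

lemma free_in_ne_0:
  assumes "realizes E V f (ts, A, N)" "v < length ts" "(x, f v) \<in> E" "x \<notin> f ` set (ins A v)"
  shows "free_in (ts, A, N) v \<noteq> 0"
  unfolding known_in(3)[OF assms(1,2)] using assms(3,4) finite_in[of "f v"] by auto

lemma realizes_index:
  assumes "realizes E V f (ts, A, N)" "a < length ts" "b < length ts"
  shows "f a = f b \<longleftrightarrow> a = b"
  using assms by (auto simp: inj_on_def)

text \<open>An actual arc that is not yet recorded occupies one of the free slots at both ends, so
  no true arc is ever ruled out.\<close>

lemma maybe_arc_complete:
  assumes f: "realizes E V f (ts, A, N)" and ab: "a < length ts" "b < length ts" and e: "(f a, f b) \<in> E"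
  shows "maybe_arc (ts, A, N) a b"
proof (cases "(a, b) \<in> set A")
  case False
  have "a \<noteq> b" using e no_loop by auto
  moreover have "(b, a) \<notin> set A" using f no_digon[OF e] by auto
  moreover have "(a, b) \<notin> set N" using f e by auto
  moreover have "f b \<notin> f ` set (outs A a)"
  proof
    assume "f b \<in> f ` set (outs A a)"
    then obtain w where w: "f b = f w" "(a, w) \<in> set A" by (auto simp: set_outs)
    then have "w < length ts" using f by auto
    then show False using realizes_index[OF f ab(2), of w] w False by simp
  qed
  moreover have "f a \<notin> f ` set (ins A b)"
  proof
    assume "f a \<in> f ` set (ins A b)"
    then obtain w where w: "f a = f w" "(w, b) \<in> set A" by (auto simp: set_ins)
    then have "w < length ts" using f by auto
    then show False using realizes_index[OF f ab(1), of w] w False by simp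
  qed
  ultimately have "possible (ts, A, N) a b"
    using free_out_ne_0[OF f ab(1) e] free_in_ne_0[OF f ab(2) e] False unfolding possible.simps by blast
  then show ?thesis by simp
qed simp

lemma split_arcs_complete:
  assumes "realizes E V f st"
    and "\<And>w. w \<in> set ws \<Longrightarrow> fst (arc w) < size_of st \<and> snd (arc w) < size_of st"
    and "\<And>st'. realizes E V f st' \<Longrightarrow> size_of st' = size_of st \<Longrightarrow>
        (\<And>w. w \<in> set ws \<Longrightarrow> (f (fst (arc w)), f (snd (arc w))) \<notin> E) \<Longrightarrow> \<exists>s\<in>set (k st'). realizable E V s"
  shows "\<exists>s\<in>set (split_arcs arc k ws st). realizable E V s"
  using assms
proof (induction ws arbitrary: st)
  case Nil
  then show ?case by auto
next
  case (Cons w ws)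
  have b: "fst (arc w) < size_of st" "snd (arc w) < size_of st" using Cons.prems(2)[of w] by simp_all
  show ?case
  proof (cases "(f (fst (arc w)), f (snd (arc w))) \<in> E")
    case True
    then have "realizable E V (add_arc (fst (arc w)) (snd (arc w)) st)"
      using realizes_add_arc[OF Cons.prems(1) b] unfolding realizable_def by blast
    then show ?thesis by simp
  next
    case False
    let ?st = "add_nonarc (fst (arc w)) (snd (arc w)) st"
    have r: "realizes E V f ?st" using realizes_add_nonarc[OF Cons.prems(1) b False] .
    have sz: "size_of ?st = size_of st" by (cases st) (simp add: size_of_def)
    have "\<exists>s\<in>set (split_arcs arc k ws ?st). realizable E V s"
    proof (rule Cons.IH[OF r])
      show "fst (arc x) < size_of ?st \<and> snd (arc x) < size_of ?st" if "x \<in> set ws" for x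
        using Cons.prems(2)[of x] that sz by simp
      show "\<exists>s\<in>set (k st'). realizable E V s"
        if "realizes E V f st'" "size_of st' = size_of ?st"
          "\<And>w. w \<in> set ws \<Longrightarrow> (f (fst (arc w)), f (snd (arc w))) \<notin> E" for st'
      proof (rule Cons.prems(3)[OF that(1)])
        show "size_of st' = size_of st" using that(2) sz by simp
        show "(f (fst (arc x)), f (snd (arc x))) \<notin> E" if x: "x \<in> set (w # ws)" for x
          using x False \<open>\<And>w. w \<in> set ws \<Longrightarrow> (f (fst (arc w)), f (snd (arc w))) \<notin> E\<close> by auto
      qed
    qed
    then show ?thesis by simp
  qed
qed

lemma size_add_vertex: "size_of (add_vertex t st) = Suc (size_of st)"
  by (cases st) (simp add: size_of_def)

lemma size_add_arc: "size_of (add_arc a b st) = size_of st"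
  by (cases st) (simp add: size_of_def)

end

locale typed_cex = min_cex +
  fixes T :: "(nat \<times> nat) list"
  assumes types: "v \<in> V \<Longrightarrow> (indeg E v, outdeg E v) \<in> set T"
begin

lemma out_cases_complete:
  assumes f: "realizes E V f st" and v: "v < size_of st" "free_out st v \<noteq> 0"
  shows "\<exists>s\<in>set (out_cases T v st). realizable E V s"
  unfolding out_cases_def
proof (rule split_arcs_complete[OF f])
  show "fst (v, w) < size_of st \<and> snd (v, w) < size_of st"
    if "w \<in> set (filter (possible st v) [0..<size_of st])" for w
    using that v by auto
next
  fix st' assume f': "realizes E V f st'" and sz: "size_of st' = size_of st"
    and no: "\<And>w. w \<in> set (filter (possible st v) [0..<size_of st]) \<Longrightarrow> (f (fst (v, w)), f (snd (v, w))) \<notin> E"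
  obtain ts A N where st: "st = (ts, A, N)" by (cases st)
  have vl: "v < length ts" using v(1) by (simp add: st size_of_def)
  have "card (E `` {f v} - f ` set (outs A v)) \<noteq> 0"
    using v(2) known_out(3)[OF f[unfolded st] vl] unfolding st by simp
  then have "E `` {f v} - f ` set (outs A v) \<noteq> {}" by (metis card.empty)
  then obtain x where x: "(f v, x) \<in> E" "x \<notin> f ` set (outs A v)" by blast
  \<comment> \<open>Were the unknown neighbour a named vertex, its arc would be
    \<open>possible\<close> and thus among those just assumed absent; so it is fresh.\<close>
  have "x \<notin> f ` {..<size_of st}"
  proof
    assume "x \<in> f ` {..<size_of st}"
    then obtain w where w: "w < length ts" "x = f w" by (auto simp: st size_of_def)
    have "(v, w) \<notin> set A" using x(2) w by (auto simp: set_outs)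
    then have "possible st v w"
      using maybe_arc_complete[OF f[unfolded st] vl w(1)] x(1) w(2) unfolding st by simp
    then show False using no[of w] x(1) w by (simp add: st size_of_def)
  qed
  then have nx: "x \<notin> f ` {..<size_of st'}" using sz by simp
  have xV: "x \<in> V" using E_V[OF x(1)] by simp
  let ?s = "add_vertex (indeg E x, outdeg E x) st'"
  have "realizes E V (f(size_of st' := x)) (add_arc v (size_of st') ?s)"
    using realizes_add_arc[OF realizes_add_vertex[OF f' xV nx], of v "size_of st'"] v(1) sz x(1)
    by (simp add: size_add_vertex)
  then have "realizable E V (add_arc v (size_of st') ?s)" unfolding realizable_def by blast
  then show "\<exists>s\<in>set (map (\<lambda>t. add_arc v (size_of st') (add_vertex t st')) T). realizable E V s"
    using types[OF xV] by auto
qed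

lemma in_cases_complete:
  assumes f: "realizes E V f st" and v: "v < size_of st" "free_in st v \<noteq> 0"
  shows "\<exists>s\<in>set (in_cases T v st). realizable E V s"
  unfolding in_cases_def
proof (rule split_arcs_complete[OF f])
  show "fst (w, v) < size_of st \<and> snd (w, v) < size_of st"
    if "w \<in> set (filter (\<lambda>w. possible st w v) [0..<size_of st])" for w
    using that v by auto
next
  fix st' assume f': "realizes E V f st'" and sz: "size_of st' = size_of st"
    and no: "\<And>w. w \<in> set (filter (\<lambda>w. possible st w v) [0..<size_of st]) \<Longrightarrow> (f (fst (w, v)), f (snd (w, v))) \<notin> E"
  obtain ts A N where st: "st = (ts, A, N)" by (cases st)
  have vl: "v < length ts" using v(1) by (simp add: st size_of_def)
  have "card (E\<inverse> `` {f v} - f ` set (ins A v)) \<noteq> 0"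
    using v(2) known_in(3)[OF f[unfolded st] vl] unfolding st by simp
  then have "E\<inverse> `` {f v} - f ` set (ins A v) \<noteq> {}" by (metis card.empty)
  then obtain x where x: "(x, f v) \<in> E" "x \<notin> f ` set (ins A v)" by blast
  have "x \<notin> f ` {..<size_of st}"
  proof
    assume "x \<in> f ` {..<size_of st}"
    then obtain w where w: "w < length ts" "x = f w" by (auto simp: st size_of_def)
    have "(w, v) \<notin> set A" using x(2) w by (auto simp: set_ins)
    then have "possible st w v"
      using maybe_arc_complete[OF f[unfolded st] w(1) vl] x(1) w(2) unfolding st by simp
    then show False using no[of w] x(1) w by (simp add: st size_of_def)
  qed
  then have nx: "x \<notin> f ` {..<size_of st'}" using sz by simp
  have xV: "x \<in> V" using E_V[OF x(1)] by simp
  let ?s = "add_vertex (indeg E x, outdeg E x) st'"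
  have "realizes E V (f(size_of st' := x)) (add_arc (size_of st') v ?s)"
    using realizes_add_arc[OF realizes_add_vertex[OF f' xV nx], of "size_of st'" v] v(1) sz x(1)
    by (simp add: size_add_vertex)
  then have "realizable E V (add_arc (size_of st') v ?s)" unfolding realizable_def by blast
  then show "\<exists>s\<in>set (map (\<lambda>t. add_arc (size_of st') v (add_vertex t st')) T). realizable E V s"
    using types[OF xV] by auto
qed

lemma tri_cases_complete:
  assumes f: "realizes E V f st" and ab: "(a, b) \<in> set (fst (snd st))"
    and poor: "snd (fst st ! a) = 2 \<or> fst (fst st ! b) = 2"
  shows "\<exists>s\<in>set (tri_cases T a b st). realizable E V s"
proof -
  obtain ts A N where st: "st = (ts, A, N)" by (cases st)
  note f' = f[unfolded st]
  have ab': "a < length ts" "b < length ts" "(f a, f b) \<in> E" using f' ab by (auto simp: st)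
  have "outdeg E (f a) = 2 \<or> indeg E (f b) = 2" using poor f' ab' by (simp add: st)
  then obtain x where x: "(f b, x) \<in> E" "(x, f a) \<in> E" using poor_arc_triangle[OF ab'(3)] by blast
  show ?thesis
  proof (cases "x \<in> f ` {..<length ts}")
    case True
    then obtain y where y: "y < length ts" "x = f y" by auto
    have "maybe_arc st b y" "maybe_arc st y a"
      using maybe_arc_complete[OF f'] ab' y x by (simp_all add: st del: maybe_arc.simps)
    moreover have "realizes E V f (add_arc y a (add_arc b y st))"
      using ab' y x f by (intro realizes_add_arc) (simp_all add: size_add_arc, simp_all add: st size_of_def)
    then have "realizable E V (add_arc y a (add_arc b y st))" unfolding realizable_def by blast
    ultimately show ?thesis using y unfolding tri_cases_def by (auto simp: st size_of_def simp del: maybe_arc.simps add_arc.simps)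
  next
    case False
    have "set (outs A b) \<subseteq> {..<length ts}" "set (ins A a) \<subseteq> {..<length ts}"
      using f' by (auto simp: set_outs set_ins)
    then have free: "free_out st b \<noteq> 0" "free_in st a \<noteq> 0"
      using free_out_ne_0[OF f' ab'(2) x(1)] free_in_ne_0[OF f' ab'(1) x(2)] False unfolding st by blast+
    have nx: "x \<notin> f ` {..<size_of st}" using False by (simp add: st size_of_def)
    have xV: "x \<in> V" using E_V[OF x(1)] by simp
    let ?n = "size_of st" and ?s = "add_vertex (indeg E x, outdeg E x) st"
    have "realizes E V (f(?n := x)) (add_arc ?n a (add_arc b ?n ?s))"
      using ab' x realizes_add_vertex[OF f xV nx]
      by (intro realizes_add_arc) (simp_all add: size_add_arc size_add_vertex, simp_all add: st size_of_def)
    then have "realizable E V (add_arc ?n a (add_arc b ?n ?s))" unfolding realizable_def by blast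
    then show ?thesis using free types[OF xV] unfolding tri_cases_def by auto
  qed
qed

lemma peels_sound:
  assumes "realizes E V f st" "\<forall>v\<in>set vs. v < size_of st" "peels st R vs"
  shows "peelable E (f ` set R) (map f vs)"
  using assms(2,3)
proof (induction vs arbitrary: R)
  case Nil then show ?case by simp
next
  case (Cons v vs)
  obtain ts A N where st: "st = (ts, A, N)" by (cases st)
  note f = assms(1)[unfolded st]
  have v: "v < length ts" using Cons.prems(1) by (simp add: st size_of_def)
  have "E `` {f v} \<subseteq> f ` set R \<or> E\<inverse> `` {f v} \<subseteq> f ` set R"
  proof -
    have "free_out st v = 0 \<and> set (outs A v) \<subseteq> set R \<or> free_in st v = 0 \<and> set (ins A v) \<subseteq> set R"
      using Cons.prems(2) unfolding st by simp
    then show ?thesis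
    proof
      assume a: "free_out st v = 0 \<and> set (outs A v) \<subseteq> set R"
      then have "card (E `` {f v} - f ` set (outs A v)) = 0"
        using known_out(3)[OF f v] by (simp only: st)
      then have "E `` {f v} \<subseteq> f ` set (outs A v)" using finite_out[of "f v"] by simp
      then show ?thesis using a by blast
    next
      assume a: "free_in st v = 0 \<and> set (ins A v) \<subseteq> set R"
      then have "card (E\<inverse> `` {f v} - f ` set (ins A v)) = 0"
        using known_in(3)[OF f v] by (simp only: st)
      then have "E\<inverse> `` {f v} \<subseteq> f ` set (ins A v)" using finite_in[of "f v"] by simp
      then show ?thesis using a by blast
    qed
  qed
  moreover have "peels st (v # R) vs" using Cons.prems(2) unfolding st by simp
  then have "peelable E (f ` set (v # R)) (map f vs)" using Cons.IH[of "v # R"] Cons.prems(1) by simp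
  ultimately show ?case by simp
qed

text \<open>Out-neighbours in \<open>X\<close> are known ones or unknown ones; the latter are
  limited both by the free slots of \<open>v\<close> and by the vertices of \<open>X\<close> that
  are still \<open>possible\<close>.\<close>

lemma inner_bound_sound:
  assumes f: "realizes E V f (ts, A, N)" and v: "v < length ts" and X: "\<forall>w\<in>set X. w < length ts"
  shows "card (E `` {f v} \<inter> f ` set X) \<le> inner_bound (ts, A, N) X v"
proof -
  let ?K = "set (filter (\<lambda>w. w \<in> set X) (outs A v))" and ?P = "filter (possible (ts, A, N) v) X"
  let ?R = "(E `` {f v} - f ` set (outs A v)) \<inter> f ` set X"
  have "E `` {f v} \<inter> f ` set X \<subseteq> f ` ?K \<union> ?R"
  proof
    fix x assume x: "x \<in> E `` {f v} \<inter> f ` set X"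
    show "x \<in> f ` ?K \<union> ?R"
    proof (cases "x \<in> f ` set (outs A v)")
      case True
      then obtain w where w: "x = f w" "w \<in> set (outs A v)" by blast
      obtain u where u: "x = f u" "u \<in> set X" using x by blast
      have "w < length ts" using w(2) f by (auto simp: set_outs)
      then have "u = w" using realizes_index[OF f, of u w] X u w by simp
      then show ?thesis using u w by auto
    qed (use x in auto)
  qed
  then have "card (E `` {f v} \<inter> f ` set X) \<le> card (f ` ?K \<union> ?R)" by (intro card_mono) auto
  also have "\<dots> \<le> card (f ` ?K) + card ?R" by (rule card_Un_le)
  also have "card (f ` ?K) \<le> length (filter (\<lambda>w. w \<in> set X) (outs A v))"
    by (meson card_image_le card_length finite_set le_trans)
  also have "card ?R \<le> free_out (ts, A, N) v"
    unfolding known_out(3)[OF f v] using finite_out[of "f v"] by (intro card_mono) auto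
  finally have 1: "card (E `` {f v} \<inter> f ` set X) \<le>
      length (filter (\<lambda>w. w \<in> set X) (outs A v)) + card ?R \<and> card ?R \<le> free_out (ts, A, N) v"
    using \<open>card ?R \<le> free_out (ts, A, N) v\<close>
      \<open>card (E `` {f v} \<inter> f ` set X) \<le> card (f ` ?K \<union> ?R)\<close> \<open>card (f ` ?K \<union> ?R) \<le> card (f ` ?K) + card ?R\<close>
      \<open>card (f ` ?K) \<le> length (filter (\<lambda>w. w \<in> set X) (outs A v))\<close> by linarith
  have "?R \<subseteq> f ` set ?P"
  proof
    fix x assume "x \<in> ?R"
    then obtain w where w: "x = f w" "w \<in> set X" "(f v, f w) \<in> E" "f w \<notin> f ` set (outs A v)" by auto
    then have "(v, w) \<notin> set A" by (auto simp: set_outs)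
    then have "possible (ts, A, N) v w"
      using maybe_arc_complete[OF f v _ w(3)] X w(2) by (simp del: possible.simps)
    then show "x \<in> f ` set ?P" using w by (simp del: possible.simps)
  qed
  then have "card ?R \<le> card (f ` set ?P)" by (intro card_mono) auto
  also have "\<dots> \<le> length ?P" by (meson card_image_le card_length finite_set le_trans)
  finally have "card ?R \<le> length ?P" .
  moreover have aux: "r \<le> (if k = 0 then 0 else min k l)" if "r \<le> k" "r \<le> l" for r k l :: nat
    using that by simp
  ultimately have "card ?R \<le> (if free_out (ts, A, N) v = 0 then 0 else min (free_out (ts, A, N) v) (length ?P))"
    using aux[OF conjunct2[OF 1]] by blast
  then show ?thesis using 1 unfolding inner_bound.simps Let_def by linarith
qed

lemma wins_sound:
  assumes f: "realizes E V f st" and w: "wins st S D"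
  shows False
proof -
  obtain ts A N where st: "st = (ts, A, N)" by (cases st)
  note f' = f[unfolded st]
  let ?X = "S @ D"
  have S: "S \<noteq> []" and dist: "distinct ?X" and X: "\<forall>v\<in>set ?X. v < length ts"
    and p: "peels st D S"
    and val: "7 * length ?X + sum_list (map (inner_bound st ?X) ?X) \<le>
     9 * length S + sum_list (map (\<lambda>v. fst (ts ! v) + snd (ts ! v)) ?X)"
    using w unfolding st wins.simps by blast+
  have inj: "inj_on f (set ?X)" using f' X by (auto intro: inj_on_subset)
  have XV: "f ` set ?X \<subseteq> V" using f' X by auto
  have un: "set (map f S) \<union> f ` set D = f ` set ?X" by auto
  have "9 * length (map f S) + (\<Sum>v\<in>f ` set ?X. deg E v) <
      7 * card (f ` set ?X) + card (Restr E (f ` set ?X))"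
    unfolding un[symmetric]
  proof (rule peel_reduction)
    show "distinct (map f S)" using dist inj by (simp add: distinct_map inj_on_Un)
    show "set (map f S) \<inter> f ` set D = {}" using dist inj by (auto simp: inj_on_def)
    show "set (map f S) \<union> f ` set D \<subseteq> V" using XV by auto
    show "map f S \<noteq> []" using S by simp
    show "peelable E (f ` set D) (map f S)"
      using X by (intro peels_sound[OF f _ p]) (simp add: st size_of_def)
  qed
  moreover have "(\<Sum>v\<in>f ` set ?X. deg E v) = sum_list (map (\<lambda>v. fst (ts ! v) + snd (ts ! v)) ?X)"
  proof -
    have "(\<Sum>v\<in>f ` set ?X. deg E v) = (\<Sum>v\<in>set ?X. deg E (f v))" using inj by (simp add: sum.reindex)
    also have "\<dots> = (\<Sum>v\<in>set ?X. fst (ts ! v) + snd (ts ! v))"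
      using f' X by (intro sum.cong) auto
    finally show ?thesis using dist by (simp only: sum_list_distinct_conv_sum_set)
  qed
  moreover have "card (f ` set ?X) = length ?X"
    using inj dist by (simp only: card_image distinct_card)
  moreover have "card (Restr E (f ` set ?X)) \<le> sum_list (map (inner_bound st ?X) ?X)"
  proof -
    have "Restr E (f ` set ?X) = Sigma (f ` set ?X) (\<lambda>x. E `` {x} \<inter> f ` set ?X)" by auto
    then have "card (Restr E (f ` set ?X)) = (\<Sum>x\<in>f ` set ?X. card (E `` {x} \<inter> f ` set ?X))"
      by (simp only:) (subst card_SigmaI, auto)
    also have "\<dots> = (\<Sum>v\<in>set ?X. card (E `` {f v} \<inter> f ` set ?X))" using inj by (simp only: sum.reindex o_def)
    also have "\<dots> \<le> (\<Sum>v\<in>set ?X. inner_bound st ?X v)"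
      using X unfolding st by (intro sum_mono inner_bound_sound[OF f' _ X]) blast
    finally show ?thesis using dist by (simp only: sum_list_distinct_conv_sum_set)
  qed
  ultimately show False using val by simp
qed

lemma embeds_sound:
  assumes f: "realizes E V f st" and e: "embeds p st g"
  shows "realizable E V p"
proof -
  obtain ts A N where st: "st = (ts, A, N)" by (cases st)
  obtain ts' A' N' where p: "p = (ts', A', N')" by (cases p)
  have g: "distinct g" "\<And>i. i < length g \<Longrightarrow> g ! i < length ts" "ts' = map ((!) ts) g" "distinct A'" "N' = []"
    "\<forall>q\<in>set A'. fst q < length g \<and> snd q < length g \<and> (g ! fst q, g ! snd q) \<in> set A"
    using e unfolding p st embeds.simps by auto
  have "inj_on (\<lambda>i. f (g ! i)) {..<length g}"
  proof (rule inj_onI)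
    fix x y assume "x \<in> {..<length g}" "y \<in> {..<length g}" "f (g ! x) = f (g ! y)"
    then show "x = y"
      using realizes_index[OF f[unfolded st] g(2)[of x] g(2)[of y]] g(1) by (simp add: nth_eq_iff_index_eq)
  qed
  moreover have "(f (g ! fst q), f (g ! snd q)) \<in> E" if "q \<in> set A'" for q
    using bspec[OF g(6) that] f unfolding st by fastforce
  ultimately have "realizes E V (\<lambda>i. f (g ! i)) p"
    using f g unfolding st p by simp
  then show ?thesis unfolding realizable_def by blast
qed

theorem check_sound:
  assumes F: "\<And>p. p \<in> set F \<Longrightarrow> \<not> realizable E V p"
  shows "check F T c st \<Longrightarrow> \<not> realizable E V st"
proof (induction c arbitrary: st)
  case (Win S D)
  then show ?case using wins_sound unfolding realizable_def check.simps by blast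
next
  case (Emb k g)
  then show ?case using embeds_sound F nth_mem unfolding realizable_def[of E V st] check.simps by blast
next
  case (Out v cs)
  show ?case
  proof
    assume "realizable E V st"
    then obtain f where f: "realizes E V f st" unfolding realizable_def by blast
    then obtain s where s: "s \<in> set (out_cases T v st)" "realizable E V s"
      using out_cases_complete[OF f] Out.prems unfolding check.simps by blast
    then obtain i where i: "i < length (out_cases T v st)" "s = out_cases T v st ! i"
      by (auto simp: in_set_conv_nth)
    then have "i < length cs" "check F T (cs ! i) s"
      using Out.prems by (auto simp: list_all2_conv_all_nth)
    then show False using Out.IH[of "cs ! i" s] s by simp
  qed
next
  case (In v cs)
  show ?case
  proof
    assume "realizable E V st"
    then obtain f where f: "realizes E V f st" unfolding realizable_def by blast
    then obtain s where s: "s \<in> set (in_cases T v st)" "realizable E V s"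
      using in_cases_complete[OF f] In.prems unfolding check.simps by blast
    then obtain i where i: "i < length (in_cases T v st)" "s = in_cases T v st ! i"
      by (auto simp: in_set_conv_nth)
    then have "i < length cs" "check F T (cs ! i) s"
      using In.prems by (auto simp: list_all2_conv_all_nth)
    then show False using In.IH[of "cs ! i" s] s by simp
  qed
next
  case (Tri a b cs)
  show ?case
  proof
    assume "realizable E V st"
    then obtain f where f: "realizes E V f st" unfolding realizable_def by blast
    then obtain s where s: "s \<in> set (tri_cases T a b st)" "realizable E V s"
      using tri_cases_complete[OF f] Tri.prems unfolding check.simps by blast
    then obtain i where i: "i < length (tri_cases T a b st)" "s = tri_cases T a b st ! i"
      by (auto simp: in_set_conv_nth)
    then have "i < length cs" "check F T (cs ! i) s"
      using Tri.prems by (auto simp: list_all2_conv_all_nth)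
    then show False using Tri.IH[of "cs ! i" s] s by simp
  qed
next
  case (Split a b c d)
  show ?case
  proof
    assume "realizable E V st"
    then obtain f where f: "realizes E V f st" by (auto simp: realizable_def)
    show False
    proof (cases "(f a, f b) \<in> E")
      case True
      then show False
        using Split.IH(1)[of "add_arc a b st"] Split.prems realizes_add_arc[OF f, of a b]
        by (auto simp: realizable_def)
    next
      case False
      then show False
        using Split.IH(2)[of "add_nonarc a b st"] Split.prems realizes_add_nonarc[OF f, of a b]
        by (auto simp: realizable_def)
    qed
  qed
qed

end

section \<open>The case distinctions\<close>

fun rev_state :: "state \<Rightarrow> state" where
  "rev_state (ts, A, N) = (map prod.swap ts, map prod.swap A, map prod.swap N)"

definition arc_46 :: state where
  "arc_46 = ([(2, 2), (3, 3)], [(0, 1)], [])"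

definition fives :: state where
  "fives = ([(2, 2), (2, 3), (3, 2)], [(0, 1), (0, 2), (1, 2)], [])"

text \<open>The one configuration that the deletion inequality cannot refute in the 6-regular case;
  it falls to \<open>no_paley\<close> instead.\<close>

definition paley7_state :: state where
  "paley7_state = (replicate 7 (3, 3), concat (map (\<lambda>i. map (\<lambda>d. (i, (i + d) mod 7)) [1, 2, 4]) [0..<7]), [])"

text \<open>Two directed triangles sharing the arc from 0 to 1.\<close>

definition diamond :: state where
  "diamond = (replicate 4 (2, 2), [(0, 1), (1, 2), (1, 3), (2, 0), (3, 0)], [])"

text \<open>\<open>True\<close> reverses the arc between \<open>i\<close> and its successor, so
  alternating lists give cycles of alternating sources and sinks. The letters T and F in later names
  spell this list.\<close>

definition orient_cycle :: "bool list \<Rightarrow> state" where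
  "orient_cycle bs = (replicate (length bs) (2, 2),
     map (\<lambda>i. let j = Suc i mod length bs in if bs ! i then (j, i) else (i, j)) [0..<length bs], [])"

text \<open>The trees were found by a proof-number search. In the 4-regular case, diamonds and certain
  short cycles are excluded first; the last tree then follows an alternating path
  \<open>v1 \<rightarrow> b \<leftarrow> v2 \<rightarrow> c \<leftarrow> v3\<close>, where three vertices with four out-neighbours in total suffice.\<close>

lemma certificate_arc_46:
  "check [] [(2, 2), (2, 3), (3, 2), (3, 3)] (
    Tri 0 1 [Out 0 [Split 3 1 (Out 3 [Win [3,0] [1,2], Win [3,0] [1,4], Win [3,0] [1,4], Win
    [3,0] [1,4], Win [3,0] [1,4]]) (Split 1 3 (In 2 [Win [3,2] [0,1], Split 1 4 (Tri 4 2 [Win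
    [4,2] [1,5], Win [4,2] [1,5], Win [4,2] [1,5], Win [4,2] [1,5]]) (Split 4 1 (In 1 [Split 2 5
    (Tri 4 2 [Win [4,5] [1,2]]) (Win [1,2,3] [0,4,5]), Split 2 5 (Tri 4 2 [Split 3 4 (Split 3 5
    (Win [5,4] [2,3]) (Win [2,3,4] [0,1,5])) (Win [2,3,4] [0,1,5])]) (Win [1,2,3] [0,4,5]), Win
    [1,2,3] [0,4,5], Win [1,2,3] [0,4,5]]) (Win [2] [1,4])), Split 1 4 (Win [2] [1,4]) (Win [2]
    [1,4]), Split 1 4 (Win [2] [1,4]) (Win [2] [1,4]), Win [2] [1,4]]) (Win [0] [1,3])), Split 1
    3 (Win [3] [0,1]) (Win [0] [1,3]), Split 1 3 (Win [0] [1,3]) (Win [0] [1,3]), Win [0]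
    [1,3]], In 2 [Split 1 3 (Win [2] [1,3]) (Win [2] [1,3]), Win [2] [1,3], Win [2] [1,3], Win
    [2] [1,3]], Out 0 [Split 3 1 (Out 3 [Win [3,0] [1,2], Win [3,0] [1,4], Win [3,0] [1,4], Win
    [3,0] [1,4], Win [3,0] [1,4]]) (Split 1 3 (Out 1 [Split 2 4 (Win [4] [1,2]) (Split 3 4 (Win
    [3,4] [0,1]) (In 4 [Split 5 0 (Win [4] [1,5]) (Split 5 1 (Split 2 5 (Split 3 2 (Split 3 5
    (Win [2,3] [0,5]) (Win [3,5,2] [0,1,4])) (Win [3,5,2] [0,1,4])) (Win [1,5,0] [2,3,4])) (Win
    [4] [1,5])), Win [4] [1,5], Win [4] [1,5], Win [4] [1,5]])), Split 2 4 (Win [4] [1,2])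
    (Split 3 4 (Win [3,4] [0,1]) (In 4 [Win [4] [1,5], Win [4] [1,5], Win [4] [1,5], Win [4]
    [1,5]])), Split 3 4 (Tri 3 4 [Tri 1 3 [Win [0,3,1] [2,4,5], Win [0,3,1] [2,4,5], Win [0,3,1]
    [2,4,5], Win [0,3,1] [2,4,5]]]) (Split 3 2 (Out 3 [Win [3,1,0] [2,4,5], Win [3,1,0] [2,4,5],
    Win [3,1,0] [2,4,5], Win [3,1,0] [2,4,5]]) (Out 4 [Tri 0 3 [], Win [1,0] [2,3,4], Win [1,0]
    [2,3,4], Win [1,0] [2,3,4], Win [1,0] [2,3,4], Win [1,0] [2,3,4]])), Split 2 4 (Win [2]
    [0,4]) (Split 4 0 (Win [0] [2,4]) (Split 3 2 (Split 3 4 (Win [3,1,0] [2,4]) (Win [1,0]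
    [2,3,4])) (Win [1,0] [2,3,4])))]) (Win [0] [1,3])), Split 1 3 (Win [3] [0,1]) (Win [0]
    [1,3]), Split 1 3 (Win [0] [1,3]) (Win [0] [1,3]), Win [0] [1,3]], Out 0 [In 0 [Split 2 4
    (Tri 0 3 [Tri 4 0 [Win [4,0] [1,2], Win [4,0] [2,3]], Win [4,0] [2,3]]) (Split 4 2 (Split 2
    3 (Win [3,4] [0,2]) (Split 3 1 (Tri 0 3 [Win [3,0,4] [1,2], Win [3,0] [1,4]]) (Split 1 3
    (Out 1 [Tri 0 3 [Tri 1 3 [Win [3,4,1] [0,2,5], Win [3] [2,5], Win [3] [2,5], Win [3] [2,5]],
    Win [3,4] [0,1]], Win [1,0,4] [2,3,5], Win [1,0,4] [2,3,5], Win [1,0,4] [2,3,5], Win [1,0,4]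
    [2,3,5]]) (Win [0] [1,3])))) (Win [0] [2,4])), Split 2 4 (Win [0] [2,4]) (Win [0] [2,4]),
    Split 2 4 (Win [0] [2,4]) (Win [0] [2,4]), Win [0] [2,4]], Split 1 3 (Win [3] [0,1]) (Win
    [0] [1,3]), Split 1 3 (Win [0] [1,3]) (Win [0] [1,3]), Win [0] [1,3]]])
    arc_46"
  by code_simp

text \<open>With both orientations of \<open>arc_46\<close> available, a branch with a (3,3)
  neighbour of a (2,2) vertex can be closed at once by \<open>Emb\<close>.\<close>

lemma certificate_fives:
  "check [arc_46, rev_state arc_46] [(2, 2), (2, 3), (3, 2), (3, 3)] (
    In 1 [Out 3 [Win [0,3] [1,2], Win [0,3] [1,2], Split 1 4 (Win [1,4] [0,3]) (Split 2 4 (Out 2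
    [Win [3,2,0] [1,4], Split 1 5 (Win [0,5] [1,2]) (Win [2,3,0] [1,4,5]), Win [2,3,0] [1,4,5],
    Win [2,3,0] [1,4,5], Win [2] [4,5]]) (Split 4 0 (Tri 4 0 []) (Split 4 2 (In 4 [Win [1,4,2]
    [0,3,5], Win [1,4,2] [0,3,5], Win [1,4,2] [0,3,5], Emb 1 [4,5]]) (Split 2 3 (Out 2 [Win
    [3,2,0] [1,4,5], Win [3,2,0] [1,4,5], Win [3,2,0] [1,4,5], Win [2] [3,5]]) (Win [0,3]
    [1,2,4]))))), Split 1 4 (Win [1,4] [0,3]) (Win [3] [1,4]), Split 1 4 (Split 2 4 (Out 2 [Win
    [3,2,0] [1,4], Split 1 5 (Win [0,5] [1,2]) (Win [2,3,0] [1,4,5]), Win [2] [4,5], Win [2]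
    [4,5], Win [2] [4,5]]) (Out 1 [Split 2 3 (Split 2 5 (Win [0,5] [1,2]) (Win [1,3,0] [2,4,5]))
    (Win [1,3,0] [2,4,5]), Split 2 3 (Split 2 5 (Win [0,5] [1,2]) (Win [1,3,0] [2,4,5])) (Win
    [1,3,0] [2,4,5]), Win [1,3,0] [2,4,5], Win [1,3,0] [2,4,5]])) (Win [3] [1,4]), Emb 0 [3,4]],
    Split 3 0 (Tri 3 0 [In 0 [Win [0,1] [3,4], Win [0,1] [3,4], Win [0,1] [3,4], Emb 1 [0,4]]])
    (Win [1] [0,3]), Split 3 0 (Win [0,3] [1,2]) (Win [1] [0,3]), Win [1] [0,3]])
    fives"
  by code_simp

lemma certificate_vertex_5:
  "check [arc_46, rev_state arc_46, fives, rev_state fives] [(2, 2), (2, 3), (3, 2), (3, 3)] (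
    In 0 [Out 1 [In 0 [Out 2 [Win [2,1] [0,3], Win [2,1] [0,3], Win [2,1] [0,3], Emb 0 [2,3]],
    In 2 [Win [0,2] [1,3], Win [1,3] [0,2], Split 3 1 (Win [1,3] [0,2]) (Split 4 1 (Win [1,4]
    [0,2]) (Split 0 4 (Tri 0 4 [In 3 [Win [2,3,0] [1,4], Win [2,3,0] [1,4,5], Win [2,3,0]
    [1,4,5], Win [2,3,0] [1,4,5], Emb 1 [3,5]]]) (Split 2 3 (Tri 2 3 [In 4 [Win [0,4,2] [1,3,5],
    Win [0,4,2] [1,3,5], Win [0,4,2] [1,3,5], Emb 1 [4,5]]]) (Split 3 4 (Out 4 [Win [1,4,3]
    [0,2,5], Win [1,4,3] [0,2,5], Win [1,4,3] [0,2,5], Emb 0 [4,5]]) (Split 4 3 (Out 3 [Win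
    [1,3,4] [0,2,5], Win [1,3,4] [0,2,5], Win [1,3,4] [0,2,5], Emb 0 [3,5]]) (Win [0,2]
    [1,3,4])))))), Split 3 1 (Win [1,3] [0,2]) (Split 2 3 (Tri 2 3 [Split 0 4 (Win [0,4,2]
    [1,3]) (Win [3] [0,4])]) (Split 4 3 (In 3 [Win [2,3,0] [1,4,5], Win [2,3,0] [1,4,5], Win
    [2,3,0] [1,4,5], Emb 1 [3,5]]) (In 4 [Tri 0 4 [In 1 [Win [1,2] [4,5], Win [1,2] [4,5], Win
    [1,2] [4,5], Emb 1 [1,5]]], Win [3] [0,4], Win [0,2] [1,3,4], Win [0,2] [1,3,4], Win [0,2]
    [1,3,4], Win [0,2] [1,3,4]]))), Split 3 1 (Win [1,3] [0,2]) (Split 4 1 (Win [1,4] [0,2])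
    (Split 2 3 (Tri 2 3 [Split 0 4 (Emb 2 [3,0,4]) (Win [3] [0,4])]) (In 4 [Split 3 4 (Emb 2
    [3,0,4]) (Split 4 3 (Out 3 [Win [1,3,4] [0,2,5], Win [1,3,4] [0,2,5], Win [1,3,4] [0,2,5],
    Emb 0 [3,5]]) (Win [0,2] [1,3,4])), Win [3] [0,4], Win [0,2] [1,3,4], Win [0,2] [1,3,4], Win
    [0,2] [1,3,4], Win [0,2] [1,3,4]]))), Emb 1 [2,4]], Split 3 1 (Tri 3 1 [In 1 [Win [1,0]
    [3,4], Win [1,0] [3,4], Win [1,0] [3,4], Emb 1 [1,4]]]) (Win [0] [1,3]), Split 3 1 (Win
    [1,3] [0,2]) (Win [0] [1,3]), Win [0] [1,3]], Split 0 2 (In 0 [Win [0,2] [1,3], Win [0,2]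
    [1,3], Win [0,2] [1,3], Win [0,2] [1,3]]) (Split 2 0 (In 2 [Win [2,0] [1,3], Win [2,0]
    [1,3], Win [2,0] [1,3], Win [2,0] [1,3]]) (Win [1] [0,2])), Split 0 2 (Emb 2 [1,0,2]) (Split
    2 0 (Out 2 [Win [2,1] [0,3], Win [2,1] [0,3], Win [2,1] [0,3], Win [2,1] [0,3]]) (Win [1]
    [0,2])), Emb 0 [1,2]], In 0 [Split 1 2 (In 2 [Win [2,0] [1,3], Win [2,0] [1,3], Win [2,0]
    [1,3], Emb 1 [2,3]]) (Split 2 1 (In 1 [Win [1,0] [2,3], Win [1,0] [2,3], Win [1,0] [2,3],
    Win [1,0] [2,3]]) (Win [0] [1,2])), Split 1 2 (Win [0] [1,2]) (Win [0] [1,2]), Split 1 2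
    (Win [0] [1,2]) (Win [0] [1,2]), Win [0] [1,2]], In 0 [Split 1 2 (Out 2 [Win [2,1] [0,3],
    Win [2,1] [0,3], Win [2,1] [0,3], Emb 0 [2,3]]) (Split 2 1 (Out 1 [Win [1,2] [0,3], Win
    [1,2] [0,3], Win [1,2] [0,3], Win [1,2] [0,3]]) (Win [0] [1,2])), Split 1 2 (Win [1] [0,2])
    (Win [0] [1,2]), Split 1 2 (Win [1] [0,2]) (Win [0] [1,2]), Win [0] [1,2]], In 0 [Split 1 2
    (Emb 1 [2,1]) (Win [0] [1,2]), Win [0] [1,2], Win [0] [1,2], Win [0] [1,2]]])
    ([(2, 3)], [], [])"
  by code_simp

text \<open>All leaves are wins except two, in which the neighbourhood has closed up into the Paley
  graph.\<close>

lemma certificate_cubic: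
  "check [paley7_state] [(3, 3)] (
    Out 0 [Out 0 [Out 0 [Split 1 2 (Split 1 3 (Out 1 [Win [1,0] [2,3,4]]) (Out 3 [In 1 [Split 3
    2 (Win [1,2] [0,3,4]) (Split 2 3 (Split 4 3 (Win [3,1] [0,2,4]) (In 0 [Out 3 [In 2 [Win
    [0,4] [1,2,3], In 0 [Out 1 [Split 4 5 (Win [2,4] [0,1,5]) (Split 5 3 (Win [0,5] [1,2,3]) (In
    0 [Out 1 [In 3 [Out 3 [Out 4 [In 5 [Out 5 [In 4 [Out 2 [Emb 0 [0,1,2,6,3,5,4], Win [3]
    [0,2,6]], Win [5] [0,2,4]], Win [3] [1,4,5]], Win [0] [4,5,6]], Win [0] [4,5,6]], Win
    [0,2,3] [1,4,5,6]], Win [3] [0,2,7]], Win [0,1,2] [3,4,5,6]]])), Win [2] [0,1,5]], Win [2]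
    [0,1,5]]], Win [1] [0,3,4]], Win [1] [0,3,4]])) (Win [0] [1,2,3]))], Win [2] [0,1,3], Win
    [0] [1,2,3]])) (Split 2 3 (In 1 [Out 2 [Win [2,0] [1,3,4]], Win [0] [1,2,3], Win [0]
    [1,2,3]]) (In 1 [Split 3 1 (In 2 [In 2 [Win [2,1] [0,3,4]], Win [1] [0,2,3]]) (Out 1 [In 2
    [In 1 [Split 4 2 (Win [2,1] [0,3,4]) (In 0 [Out 2 [In 3 [Win [0,4] [1,2,3], In 0 [Out 1
    [Split 4 5 (Win [3,4] [0,1,5]) (Split 5 2 (Win [0,5] [1,2,3]) (In 0 [Out 1 [In 2 [Out 2 [Out
    4 [In 5 [Out 5 [In 4 [Out 3 [Emb 0 [0,1,3,6,2,5,4], Win [2] [0,3,6]], Win [5] [0,3,4]], Win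
    [2] [1,4,5]], Win [0] [4,5,6]], Win [0] [4,5,6]], Win [0,3,2] [1,4,5,6]], Win [2] [0,3,7]],
    Win [0,1,3] [2,4,5,6]]])), Win [3] [0,1,5]], Win [3] [0,1,5]]], Win [1] [0,2,4]], Win [1]
    [0,2,4]])], Win [0] [1,2,3]], Win [0] [1,2,3]]), Win [0] [1,2,3], Win [0] [1,2,3]]))]]])
    ([(3, 3)], [], [])"
  by code_simp

lemma certificate_diamond:
  "check [] [(2, 2)] (
    Out 2 [Win [3,0] [1,2], Win [0,1] [2,3]])
    (diamond)"
  by code_simp

lemma certificate_cycle_FFFF:
  "check [diamond] [(2, 2)] (
    Out 0 [Out 1 [Emb 0 [3,0,1,2], Win [1,0] [2,4]], Tri 2 3 [Win [0,3] [1,4], Win [0,2,3]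
    [1,4], Tri 3 0 [Win [2,3] [1,5], Split 1 4 (Win [1,3,0] [2,4]) (Split 1 5 (Win [5,2] [1,3])
    (Split 2 0 (Win [3,0] [2,4]) (Split 2 4 (Win [4,3] [0,2]) (Split 4 1 (Win [4,0] [1,3]) (Out
    4 [Win [3,5] [2,4], Win [0,2,3] [1,4,5]])))))]]])
    (orient_cycle [False, False, False, False])"
  by code_simp

lemma certificate_cycle_TFFF:
  "check [diamond, orient_cycle [False, False, False, False]] [(2, 2)] (
    In 2 [Win [0,2] [1,3], Tri 2 3 [Win [1,3] [0,2], Tri 1 2 [Split 0 4 (Emb 1 [0,4,2,3]) (Split
    0 5 (Emb 0 [5,1,0,2]) (Split 4 1 (Emb 1 [1,2,3,4]) (Out 4 [Win [2,5] [1,4], Win [3,2,1]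
    [0,4,5]])))]]])
    (orient_cycle [True, False, False, False])"
  by code_simp

lemma certificate_cycle_TFTF:
  "check [] [(2, 2)] (
    Win [1,3] [0,2])
    (orient_cycle [True, False, True, False])"
  by code_simp

lemma certificate_cycle_TFTFF:
  "check [orient_cycle [False, False, False, False], orient_cycle [True, False, False, False]] [(2, 2)] (
    In 3 [Emb 1 [2,1,0,3], Tri 4 0 [Emb 0 [0,5,3,4], Tri 3 4 [Win [2,4,0] [1,3,6], Win [2,4,0]
    [1,3,6]]]])
    (orient_cycle [True, False, True, False, False])"
  by code_simp

lemma certificate_cycle_TTFF:
  "check [diamond] [(2, 2)] (
    Out 0 [Emb 0 [0,2,1,3], Win [0,2] [1,3]])
    (orient_cycle [True, True, False, False])"
  by code_simp

lemma certificate_cycle_TFTFFF: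
  "check [diamond, orient_cycle [False, False, False, False],
     orient_cycle [True, False, False, False], orient_cycle [True, False, True, False, False],
     orient_cycle [True, True, False, False]] [(2, 2)] (
    Tri 5 0 [Emb 3 [4,3,2,1,0], Out 5 [Emb 1 [0,6,5,1], Emb 3 [2,1,0,5,3], Tri 4 5 [Emb 0
    [5,0,4,6], Split 0 3 (Emb 1 [0,3,4,5]) (Split 0 7 (Emb 1 [0,7,4,5]) (Split 2 6 (Emb 4
    [6,0,1,2]) (Split 2 7 (Emb 2 [4,3,2,7]) (Tri 3 4 [Emb 1 [4,6,5,7], Win [2,4,5,0]
    [1,3,6,7]]))))]]])
    (orient_cycle [True, False, True, False, False, False])"
  by code_simp

text \<open>Exactly tight: besides the six cycle arcs only three arcs from 0, 2, 4 to the opposite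
  vertices fit, and 27 + 24 = 42 + 9.\<close>

lemma certificate_cycle_TFTFTF:
  "check [] [(2, 2)] (
    Win [1,3,5] [0,2,4])
    (orient_cycle [True, False, True, False, True, False])"
  by code_simp

lemma certificate_cycle_TFFFF:
  "check [orient_cycle [True, False, False, False], orient_cycle [True, False, True, False],
     orient_cycle [True, True, False, False]] [(2, 2)] (
    Out 3 [Emb 2 [0,1,3,4], Tri 2 3 [Emb 1 [0,1,2,4], Split 0 3 (Emb 2 [3,0,1,2]) (Split 0 5
    (Emb 0 [2,1,0,5]) (Tri 3 4 [Win [0,2,3] [1,4,5]]))]])
    (orient_cycle [True, False, False, False, False])"
  by code_simp

lemma certificate_cycle_TFTFTFF:
  "check [diamond, orient_cycle [False, False, False, False],
     orient_cycle [True, False, False, False], orient_cycle [True, False, True, False, False, False],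
     orient_cycle [True, False, False, False, False]] [(2, 2)] (
    Tri 5 6 [Emb 3 [4,3,2,1,0,5], Split 0 3 (Emb 2 [2,1,0,3]) (Split 0 5 (Emb 0 [5,6,0,7])
    (Split 0 7 (Emb 1 [0,7,5,6]) (Split 2 5 (Emb 2 [4,3,2,5]) (Split 2 6 (Emb 2 [0,1,2,6]) (Out
    2 [Emb 4 [4,3,2,7,5], Win [1,3,6,5] [0,2,4,7]])))))])
    (orient_cycle [True, False, True, False, True, False, False])"
  by code_simp

text \<open>For three kept and four deleted vertices 27 + 28 = 49 + 6, so the six arcs of the kept
  vertices must be the only inner ones. Any further arc is refuted in its own branch, mostly by the
  short cycles excluded before.\<close>

lemma certificate_quartic:
  "check [orient_cycle [True, False, False, False], orient_cycle [True, False, True, False],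
     orient_cycle [True, False, True, False, False],
     orient_cycle [True, False, True, False, False, False],
     orient_cycle [True, False, True, False, True, False],
     orient_cycle [True, False, True, False, True, False, False]] [(2, 2)] (
    Out 0 [Out 0 [In 2 [Out 1 [Win [1,0] [2,3]], Out 3 [Win [0,3] [1,2], Emb 1 [1,0,2,3], In 4
    [Emb 2 [4,3,2,0,1], Win [2,4] [0,3], Out 5 [Emb 2 [2,3,4,5,0], Emb 4 [1,0,2,3,4,5], Win
    [3,5] [2,4], Split 1 3 (Emb 0 [2,0,1,3]) (Split 1 5 (Emb 3 [4,3,2,0,1,5]) (Split 1 6 (Emb 5
    [6,5,4,3,2,0,1]) (Split 2 1 (Win [2,1] [0,3]) (Split 2 5 (Emb 0 [4,3,2,5]) (Split 2 6 (Emb 2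
    [6,5,4,3,2]) (Split 4 0 (Emb 0 [2,3,4,0]) (Split 4 1 (Emb 2 [1,0,2,3,4]) (Split 4 6 (Win
    [4,6] [3,5]) (Split 6 0 (Emb 3 [2,3,4,5,6,0]) (Split 6 1 (Emb 5 [1,0,2,3,4,5,6]) (In 3 [Emb
    0 [4,5,6,3], Win [0,3,5] [1,2,4,6]])))))))))))]]]]]])
    ([(2, 2)], [], [])"
  by code_simp

section \<open>From the trees to the exclusion of all degree types\<close>

lemma realizable_vertex:
  "v \<in> V \<Longrightarrow> realizable E V ([(indeg E v, outdeg E v)], [], [])"
  by (auto simp: realizable_def inj_on_def intro!: exI[of _ "\<lambda>_. v"])

locale quartic_cex = typed_cex V E "[(2, 2)]" for V E
begin

lemma not_diamond: "\<not> realizable E V (diamond)"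
  by (rule check_sound[OF _ certificate_diamond]) simp

lemma not_cycle_FFFF: "\<not> realizable E V (orient_cycle [False, False, False, False])"
  by (rule check_sound[OF _ certificate_cycle_FFFF]) (use not_diamond in auto)

lemma not_cycle_TFFF: "\<not> realizable E V (orient_cycle [True, False, False, False])"
  by (rule check_sound[OF _ certificate_cycle_TFFF]) (use not_diamond not_cycle_FFFF in auto)

lemma not_cycle_TFTF: "\<not> realizable E V (orient_cycle [True, False, True, False])"
  by (rule check_sound[OF _ certificate_cycle_TFTF]) simp

lemma not_cycle_TFTFF: "\<not> realizable E V (orient_cycle [True, False, True, False, False])"
  by (rule check_sound[OF _ certificate_cycle_TFTFF]) (use not_cycle_FFFF not_cycle_TFFF in auto)

lemma not_cycle_TTFF: "\<not> realizable E V (orient_cycle [True, True, False, False])"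
  by (rule check_sound[OF _ certificate_cycle_TTFF]) (use not_diamond in auto)

lemma not_cycle_TFTFFF: "\<not> realizable E V (orient_cycle [True, False, True, False, False, False])"
  by (rule check_sound[OF _ certificate_cycle_TFTFFF])
    (use not_diamond not_cycle_FFFF not_cycle_TFFF not_cycle_TFTFF not_cycle_TTFF in auto)

lemma not_cycle_TFTFTF: "\<not> realizable E V (orient_cycle [True, False, True, False, True, False])"
  by (rule check_sound[OF _ certificate_cycle_TFTFTF]) simp

lemma not_cycle_TFFFF: "\<not> realizable E V (orient_cycle [True, False, False, False, False])"
  by (rule check_sound[OF _ certificate_cycle_TFFFF])
    (use not_cycle_TFFF not_cycle_TFTF not_cycle_TTFF in auto)

lemma not_cycle_TFTFTFF: "\<not> realizable E V (orient_cycle [True, False, True, False, True, False, False])"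
  by (rule check_sound[OF _ certificate_cycle_TFTFTFF])
    (use not_diamond not_cycle_FFFF not_cycle_TFFF not_cycle_TFTFFF not_cycle_TFFFF in auto)

lemma contradiction: "v \<in> V \<Longrightarrow> False"
proof -
  assume v: "v \<in> V"
  have "\<not> realizable E V ([(2, 2)], [], [])"
    by (rule check_sound[OF _ certificate_quartic])
      (use not_cycle_TFFF not_cycle_TFTF not_cycle_TFTFF not_cycle_TFTFFF not_cycle_TFTFTF
        not_cycle_TFTFTFF in auto)
  then show False using types[OF v] realizable_vertex[OF v, of E] by simp
qed

end

locale sextic_cex = typed_cex V E "[(3, 3)]" for V E
begin

lemma not_realizable_paley7: "\<not> realizable E V paley7_state"
proof
  assume "realizable E V paley7_state"
  then obtain f where f: "realizes E V f paley7_state" by (auto simp: realizable_def)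
  have inj: "inj_on f {..<7}" and V: "\<And>i. i < 7 \<Longrightarrow> f i \<in> V"
    using f by (auto simp: paley7_state_def)
  have arc: "(f i, f ((i + d) mod 7)) \<in> E" if "i < 7" "d \<in> {1, 2, 4}" for i d
    using f that by (auto simp: paley7_state_def)
  have fwd: "(f i, f j) \<in> E" if "i < 7" "j < 7" "(j + 7 - i) mod 7 \<in> {1, 2, 4}" for i j
  proof -
    have "(i + (j + 7 - i) mod 7) mod 7 = j" using that(1,2) by (simp add: mod_add_right_eq)
    then show ?thesis using arc[OF that(1,3)] by simp
  qed
  have "(f i, f j) \<in> E \<longleftrightarrow> (j + 7 - i) mod 7 \<in> {1, 2, 4}" if ij: "i < 7" "j < 7" for i j
  proof
    assume e: "(f i, f j) \<in> E"
    then have "i \<noteq> j" using no_loop by auto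
    \<comment> \<open>Of two opposite nonzero residues modulo 7 exactly one is in {1, 2, 4}, so the
      21 known arcs decide every pair and the copy is induced.\<close>
    then have "(j + 7 - i) mod 7 \<in> {1, 2, 4} \<or> (i + 7 - j) mod 7 \<in> {1, 2, 4}"
    proof -
      have "i \<in> {0,1,2,3,4,5,6}" "j \<in> {0,1,2,3,4,5,6}" using ij by auto
      then show ?thesis using \<open>i \<noteq> j\<close> by auto
    qed
    then show "(j + 7 - i) mod 7 \<in> {1, 2, 4}" using fwd[of j i] ij no_digon[OF e] by blast
  qed (use fwd ij in blast)
  moreover have "bij_betw f {0..<7} (f ` {0..<7})"
    using inj by (simp add: bij_betw_def atLeast0LessThan)
  ultimately have "paley_set E (f ` {0..<7})" by (intro paley_set.base)
  moreover have "f ` {0..<7} \<subseteq> V" using V by force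
  ultimately show False using no_paley by blast
qed

lemma contradiction: "v \<in> V \<Longrightarrow> False"
proof -
  assume v: "v \<in> V"
  have "\<not> realizable E V ([(3, 3)], [], [])"
    by (rule check_sound[OF _ certificate_cubic]) (use not_realizable_paley7 in auto)
  then show False using types[OF v] realizable_vertex[OF v, of E] by simp
qed

end

lemma rev_state_rev_state [simp]: "rev_state (rev_state st) = st"
  by (cases st) (simp add: o_def)

lemma realizes_converse: "realizes E V f st \<Longrightarrow> realizes (E\<inverse>) V f (rev_state st)"
  by (cases st) (auto simp: distinct_map)

lemma realizable_converse: "realizable E V (rev_state st) \<Longrightarrow> realizable (E\<inverse>) V st"
  using realizes_converse[of E V _ "rev_state st"] by (auto simp: realizable_def)

locale general_cex = typed_cex V E "[(2, 2), (2, 3), (3, 2), (3, 3)]" for V E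
begin

text \<open>The list of types is invariant under swapping, so one tree excludes a state together
  with its reversal.\<close>

lemma converse: "general_cex V (E\<inverse>)"
proof -
  interpret rev: min_cex V "E\<inverse>" by (rule converse)
  show ?thesis using rev.vertex_types by unfold_locales auto
qed

lemma not_arc_46: "\<not> realizable E V arc_46"
  by (rule check_sound[OF _ certificate_arc_46]) simp

lemma not_arc_64: "\<not> realizable E V (rev_state arc_46)"
  using realizable_converse general_cex.not_arc_46[OF converse] by blast

lemma not_fives: "\<not> realizable E V fives"
  by (rule check_sound[OF _ certificate_fives]) (use not_arc_46 not_arc_64 in auto)

lemma not_rev_fives: "\<not> realizable E V (rev_state fives)"
  using realizable_converse general_cex.not_fives[OF converse] by blast

lemma not_23: "v \<in> V \<Longrightarrow> (indeg E v, outdeg E v) \<noteq> (2, 3)"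
proof
  assume v: "v \<in> V" and "(indeg E v, outdeg E v) = (2, 3)"
  then have "realizable E V ([(2, 3)], [], [])" using realizable_vertex[OF v, of E] by simp
  moreover have "\<not> realizable E V ([(2, 3)], [], [])"
    by (rule check_sound[OF _ certificate_vertex_5])
      (use not_arc_46 not_arc_64 not_fives not_rev_fives in auto)
  ultimately show False by blast
qed

lemma regular_types:
  assumes "v \<in> V" shows "indeg E v = 2 \<and> outdeg E v = 2 \<or> indeg E v = 3 \<and> outdeg E v = 3"
  using types[OF assms] not_23[OF assms] general_cex.not_23[OF converse assms] by auto

lemma no_arc_2_3:
  assumes "(u, v) \<in> E" "outdeg E u = 2" shows "outdeg E v \<noteq> 3"
proof
  assume "outdeg E v = 3"
  moreover have "u \<in> V" "v \<in> V" "u \<noteq> v" using E_V[OF assms(1)] assms(1) no_loop by auto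
  ultimately have "realizes E V (\<lambda>i. if i = 0 then u else v) arc_46"
    using assms regular_types[of u] regular_types[of v]
    by (auto simp: arc_46_def inj_on_def less_Suc_eq)
  then show False using not_arc_46 by (auto simp: realizable_def)
qed

lemma contradiction: False
proof -
  have "V \<noteq> {}"
  proof
    assume "V = {}"
    then have "bound E V" by (auto simp: bound_def)
    then show False using cex by simp
  qed
  then obtain v where v: "v \<in> V" by blast
  \<comment> \<open>Arcs between degrees 4 and 6 are excluded in both directions, so
    \<open>A\<close> is closed and connectedness makes the counterexample regular.\<close>
  define A where "A = {x \<in> V. outdeg E x = 2}"
  have "links E A (V - A) = {}"
  proof (rule ccontr)
    assume "links E A (V - A) \<noteq> {}"
    then obtain x y where xy: "(x, y) \<in> E" "x \<in> A \<and> y \<in> V - A \<or> y \<in> A \<and> x \<in> V - A"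
      by (auto simp: links_def)
    interpret rev: general_cex V "E\<inverse>" by (rule converse)
    show False
      using no_arc_2_3[OF xy(1)] rev.no_arc_2_3[of y x] xy E_V[OF xy(1)] regular_types[of x] regular_types[of y]
      by (auto simp: A_def)
  qed
  then consider "A = {}" | "A = V" using connected[of A] by (auto simp: A_def)
  then show False
  proof cases
    case 1
    have "(indeg E x, outdeg E x) \<in> set [(3, 3)]" if "x \<in> V" for x
    proof -
      have "x \<notin> A" using 1 that by simp
      then show ?thesis using regular_types[OF that] that by (auto simp: A_def)
    qed
    then have "sextic_cex V E"
      by (intro sextic_cex.intro typed_cex.intro typed_cex_axioms.intro min_cex_axioms)
    then show False by (rule sextic_cex.contradiction[OF _ v])
  next
    case 2
    have "(indeg E x, outdeg E x) \<in> set [(2, 2)]" if "x \<in> V" for x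
    proof -
      have "x \<in> A" using 2 that by simp
      then show ?thesis using regular_types[OF that] that by (auto simp: A_def)
    qed
    then have "quartic_cex V E"
      by (intro quartic_cex.intro typed_cex.intro typed_cex_axioms.intro min_cex_axioms)
    then show False by (rule quartic_cex.contradiction[OF _ v])
  qed
qed

end

section \<open>The bound\<close>

lemma (in min_cex) contradiction: False
proof -
  have "general_cex V E"
    using vertex_types by (intro general_cex.intro typed_cex.intro typed_cex_axioms.intro min_cex_axioms) simp
  then show False by (rule general_cex.contradiction)
qed

lemma Restr_Restr: "S \<subseteq> V \<Longrightarrow> Restr (Restr E V) S = Restr E S"
  by auto

text \<open>\<open>min_cex\<close> wants all arcs inside \<open>V\<close>, while the induction runs
  over arbitrary relations; every ingredient of \<open>bound\<close> sees only arcs within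
  \<open>V\<close>.\<close>

lemma bound_Restr:
  assumes "bound (Restr E V) V" shows "bound E V"
proof -
  have "paley_parts (Restr E V) V \<subseteq> paley_parts E V"
  proof
    fix K assume K: "K \<in> paley_parts (Restr E V) V"
    then have KV: "K \<subseteq> V" and p: "paley_set (Restr E V) K" and l: "links (Restr E V) K (V - K) = {}"
      by (simp_all add: paley_parts_def)
    have "paley_set E K" by (rule paley_set_cong[OF p]) (use KV in blast)
    moreover have "links E K (V - K) \<subseteq> links (Restr E V) K (V - K)" using KV by (auto simp: links_def)
    ultimately show "K \<in> paley_parts E V" using KV l by (simp add: paley_parts_def)
  qed
  moreover have "paley_parts E V \<subseteq> paley_parts (Restr E V) V"
  proof
    fix K assume K: "K \<in> paley_parts E V"
    then have KV: "K \<subseteq> V" and p: "paley_set E K" and l: "links E K (V - K) = {}"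
      by (simp_all add: paley_parts_def)
    have "paley_set (Restr E V) K" by (rule paley_set_cong[OF p]) (use KV in blast)
    moreover have "links (Restr E V) K (V - K) \<subseteq> links E K (V - K)" by (auto simp: links_def)
    ultimately show "K \<in> paley_parts (Restr E V) V" using KV l by (simp add: paley_parts_def)
  qed
  ultimately have "paley_parts (Restr E V) V = paley_parts E V" by blast
  moreover obtain S where "S \<subseteq> V" "acyc (Restr E V) S"
    "7 * card V \<le> 9 * card S + card (Restr (Restr E V) V) + card (paley_parts (Restr E V) V)"
    using assms unfolding bound_def by blast
  ultimately show ?thesis unfolding bound_def acyc_def by (metis Restr_Restr order_refl)
qed

theorem bound_holds:
  fixes V :: "'a set"
  assumes "finite V" "asym E"
  shows "bound E V"
  using assms
proof (induction "card V" arbitrary: V E rule: less_induct)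
  case less
  show ?case
  proof (rule ccontr)
    assume no: "\<not> bound E V"
    have "min_cex V (Restr E V)"
    proof
      show "finite V" by (rule less.prems(1))
      show "Restr E V \<subseteq> V \<times> V" by simp
      show "asym (Restr E V)" by (rule asymI) (use asymD[OF less.prems(2)] in blast)
      show "\<not> bound (Restr E V) V" using no bound_Restr by blast
      show "bound E' V'" if "finite V'" "asym E'" "card V' < card V" for V' :: "'a set" and E'
        by (rule less.hyps[OF that(3,1,2)])
    qed
    then show False by (rule min_cex.contradiction)
  qed
qed

section \<open>Transfer to digraphs\<close>

definition relabel :: "('a \<Rightarrow> nat) \<Rightarrow> ('a \<times> 'a) set \<Rightarrow> 'a set \<Rightarrow> nat pair_pre_digraph" where
  "relabel g E K = \<lparr>pverts = g ` K, parcs = map_prod g g ` Restr E K\<rparr>"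

text \<open>Without parallel arcs an arc is determined by its ends, so sending it to the pair of
  relabelled ends is injective and gives an isomorphism onto a pair digraph on natural
  numbers.\<close>

lemma digraph_iso_relabel:
  assumes wf: "wf_digraph H" and nm: "nomulti_digraph H"
    and g: "inj_on g (verts H)" and arcs: "arcs_ends H = Restr E (verts H)"
  shows "digraph_iso H (with_proj (relabel g E (verts H)))"
proof -
  let ?h = "\<lparr>iso_verts = g, iso_arcs = \<lambda>e. (g (tail H e), g (head H e)),
    iso_head = snd, iso_tail = fst\<rparr>"
  interpret wf_digraph H by (rule wf)
  have "inj_on (\<lambda>e. (g (tail H e), g (head H e))) (arcs H)"
  proof (rule inj_onI)
    fix a b assume ab: "a \<in> arcs H" "b \<in> arcs H"
      "(g (tail H a), g (head H a)) = (g (tail H b), g (head H b))"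
    then have "tail H a = tail H b" "head H a = head H b"
      using g by (auto simp: inj_on_def)
    then show "a = b"
      using nomulti_digraph.no_multi_arcs[OF nm ab(1,2)] by (simp add: arc_to_ends_def)
  qed
  then have "pre_digraph.digraph_isomorphism H ?h"
    using wf g by (simp add: pre_digraph.digraph_isomorphism_def)
  moreover have "(\<lambda>e. (g (tail H e), g (head H e))) ` arcs H = map_prod g g ` arcs_ends H"
    by (simp add: arcs_ends_conv image_image)
  then have "with_proj (relabel g E (verts H)) = app_iso ?h H"
    by (simp add: relabel_def app_iso_def with_proj_def arcs)
  ultimately show ?thesis unfolding digraph_iso_def by blast
qed

lemma paley_family_relabel:
  assumes "paley_set E K" "inj_on g K"
  shows "paley_family (relabel g E K)"
  using assms
proof induction
  case (base f K)
  have K: "K = f ` {0..<7}" and inj: "inj_on f {0..<7}" using base(1) by (auto simp: bij_betw_def)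
  let ?P = "with_proj paley7" and ?R = "{(i, j). i < 7 \<and> j < 7 \<and> (j + 7 - i) mod 7 \<in> {1, 2, 4 :: nat}}"
  have parcs: "parcs paley7 = ?R"
  proof
    show "parcs paley7 \<subseteq> ?R"
    proof
      fix p assume "p \<in> parcs paley7"
      then obtain i d where p: "p = (i, (i + d) mod 7)" and i: "i < 7" and d: "d \<in> set [1, 2, 4]"
        unfolding paley7_def by auto
      have "((i + d) mod 7 + 7 - i) mod 7 \<in> {1, 2, 4}"
        using paley7_arc_steps d i by (metis atLeastLessThan_iff atLeastLessThan_upt le0)
      then show "p \<in> ?R" using i by (simp add: p)
    qed
    show "?R \<subseteq> parcs paley7"
    proof
      fix p assume "p \<in> ?R"
      then obtain i j where p: "p = (i, j)" and ij: "i < 7" "j < 7" "(j + 7 - i) mod 7 \<in> {1, 2, 4}" by blast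
      have "j = (i + (j + 7 - i) mod 7) mod 7" using ij(1,2) by (simp add: mod_add_right_eq)
      then show "p \<in> parcs paley7" unfolding p paley7_def using ij(1,3) by simp blast
    qed
  qed
  have wf: "wf_digraph ?P" by unfold_locales (auto simp: parcs, auto simp: paley7_def)
  have nm: "nomulti_digraph ?P"
    by (intro nomulti_digraph.intro wf nomulti_digraph_axioms.intro) (simp add: arc_to_ends_def prod_eq_iff)
  have v: "verts ?P = {0..<7}" by (simp add: paley7_def)
  have rr: "arcs_ends ?P = Restr ?R (verts ?P)" unfolding v unfolding with_proj_simps parcs by auto
  have "inj_on (g \<circ> f) {0..<7}" using inj base(3) K by (simp add: comp_inj_on)
  then have iso: "digraph_iso ?P (with_proj (relabel (g \<circ> f) ?R {0..<7}))"
    using digraph_iso_relabel[OF wf nm _ rr, of "g \<circ> f"] unfolding v by blast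
  have e: "Restr E K = map_prod f f ` Restr ?R {0..<7}"
  proof (rule set_eqI)
    fix p
    show "p \<in> Restr E K \<longleftrightarrow> p \<in> map_prod f f ` Restr ?R {0..<7}"
      unfolding K by (cases p) (auto simp: base(2))
  qed
  have "relabel (g \<circ> f) ?R {0..<7} = relabel g E K"
    unfolding relabel_def e map_prod_compose image_comp[symmetric] unfolding K by (rule refl)
  then show ?case using paley_family.iso[OF paley_family.paley iso] by simp
next
  case (join A B)
  have injs: "inj_on g A" "inj_on g B" "inj_on g (A \<union> B)"
    using join(7) by (auto intro: inj_on_subset)
  obtain x y where xy: "links E A B = {(x, y)}"
    using join(4) by (metis card_1_singletonE surj_pair)
  \<comment> \<open>The link may run either way; \<open>a\<close> and \<open>b\<close> are its ends
    sorted by side, as the rule \<open>join\<close> of \<open>paley_family\<close> expects.\<close>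
  define a b where "a = (if x \<in> A then x else y)" and "b = (if x \<in> A then y else x)"
  have mem: "(x, y) \<in> E" "x \<in> A \<and> y \<in> B \<or> x \<in> B \<and> y \<in> A" using xy by (auto simp: links_def)
  then have ab: "a \<in> A" "b \<in> B" "(g x, g y) = (g a, g b) \<or> (g x, g y) = (g b, g a)"
    using join(3) by (auto simp: a_def b_def)
  have "paley_family \<lparr>pverts = pverts (relabel g E A) \<union> pverts (relabel g E B),
      parcs = insert (g x, g y) (parcs (relabel g E A) \<union> parcs (relabel g E B))\<rparr>"
  proof (rule paley_family.join)
    show "paley_family (relabel g E A)" "paley_family (relabel g E B)"
      using join(5)[OF injs(1)] join(6)[OF injs(2)] .
    show "pverts (relabel g E A) \<inter> pverts (relabel g E B) = {}"
      using inj_on_image_Int[OF injs(3), of A B] join(3) by (simp add: relabel_def)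
    show "g a \<in> pverts (relabel g E A)" "g b \<in> pverts (relabel g E B)"
      using ab by (auto simp: relabel_def)
    show "(g x, g y) = (g a, g b) \<or> (g x, g y) = (g b, g a)" by (rule ab(3))
  qed
  moreover have "Restr E (A \<union> B) = insert (x, y) (Restr E A \<union> Restr E B)"
  proof -
    have "Restr E (A \<union> B) = Restr E A \<union> Restr E B \<union> links E A B" by (auto simp: links_def)
    then show ?thesis by (simp add: xy)
  qed
  ultimately show ?case by (simp add: relabel_def image_Un)
qed

context oriented_graph
begin

lemma arcs_ends_asym: "asym (arcs_ends G)"
  by (rule asymI) (rule no_digons)

lemma arcs_ends_induce: "arcs_ends (G \<restriction> K) = Restr (arcs_ends G) K"
  by (auto simp: arcs_ends_conv induce_subgraph_def)

lemma acyclic_set_if_acyc: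
  assumes S: "S \<subseteq> verts G" and ac: "acyc (arcs_ends G) S"
  shows "acyclic_set G S"
proof -
  interpret H: wf_digraph "G \<restriction> S" by (rule wellformed_induce_subgraph)
  have "\<not> H.cycle p" for p
  proof
    assume "H.cycle p"
    then obtain u where "H.awalk u p u" "p \<noteq> []" by (auto simp: H.cycle_def)
    then have "(u, u) \<in> (arcs_ends (G \<restriction> S))\<^sup>+" by (rule H.reachable1_awalkI)
    then show False using ac unfolding arcs_ends_induce acyc_def acyclic_def by blast
  qed
  then show ?thesis using S by (simp add: acyclic_set_def)
qed

lemma card_le_max_acyclic: "acyclic_set G S \<Longrightarrow> card S \<le> max_acyclic G"
proof -
  assume "acyclic_set G S"
  moreover have "finite {card S |S. acyclic_set G S}"
    by (rule finite_subset[of _ "card ` Pow (verts G)"]) (auto simp: acyclic_set_def)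
  ultimately show ?thesis unfolding max_acyclic_def by (intro Max_ge) auto
qed

text \<open>\<open>paley_set_connected\<close> turns into reachability because the set reached from
  a vertex is closed; maximality holds since no walk in a larger connected subgraph can leave
  \<open>K\<close>.\<close>

lemma paley_part_component:
  assumes K: "K \<in> paley_parts (arcs_ends G) (verts G)"
  shows "G \<restriction> K \<in> components G"
proof -
  have KV: "K \<subseteq> verts G" and p: "paley_set (arcs_ends G) K"
    and l: "links (arcs_ends G) K (verts G - K) = {}"
    using K by (simp_all add: paley_parts_def)
  obtain r where r: "r \<in> K" using paley_set_nonempty[OF p] by blast
  interpret H: wf_digraph "G \<restriction> K" by (rule wellformed_induce_subgraph)
  interpret S: pair_wf_digraph "mk_symmetric (G \<restriction> K)" by (rule H.wellformed_mk_symmetric)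
  have sym: "u \<rightarrow>\<^bsub>mk_symmetric (G \<restriction> K)\<^esub> v \<longleftrightarrow> u \<in> K \<and> v \<in> K \<and> (u \<rightarrow>\<^bsub>G\<^esub> v \<or> v \<rightarrow>\<^bsub>G\<^esub> u)" for u v
    by (auto simp: parcs_mk_symmetric arcs_ends_conv)
  have reach: "u \<rightarrow>\<^sup>*\<^bsub>mk_symmetric (G \<restriction> K)\<^esub> v" if uv: "u \<in> K" "v \<in> K" for u v
  proof -
    define A where "A = {x \<in> K. u \<rightarrow>\<^sup>*\<^bsub>mk_symmetric (G \<restriction> K)\<^esub> x}"
    have "links (arcs_ends G) A (K - A) = {}"
    proof (rule ccontr)
      assume "links (arcs_ends G) A (K - A) \<noteq> {}"
      then obtain x y where xy: "x \<in> A" "y \<in> K" "y \<notin> A" "x \<rightarrow>\<^bsub>G\<^esub> y \<or> y \<rightarrow>\<^bsub>G\<^esub> x"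
        by (auto simp: links_def)
      then have "x \<rightarrow>\<^bsub>mk_symmetric (G \<restriction> K)\<^esub> y" unfolding sym by (auto simp: A_def)
      then have "u \<rightarrow>\<^sup>*\<^bsub>mk_symmetric (G \<restriction> K)\<^esub> y"
        using xy(1) S.reachable_adj_trans by (auto simp: A_def)
      then show False using xy(2,3) by (simp add: A_def)
    qed
    moreover have "A \<subseteq> K" "u \<in> A" using uv by (auto simp: A_def)
    ultimately have "A = K" using paley_set_connected[OF p arcs_ends_asym] by blast
    then show ?thesis using uv by (auto simp: A_def)
  qed
  have "Digraph_Component.connected (G \<restriction> K)"
    unfolding connected_def using r reach by (intro strongly_connectedI) auto
  moreover have "subgraph (G \<restriction> K) G"
    using KV by (rule subgraph_induce_subgraphI)
  moreover have "H' = G \<restriction> K" if H': "subgraph (G \<restriction> K) H'" "subgraph H' G" "Digraph_Component.connected H'" for H'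
  proof -
    have stay: "v \<in> K" if "r \<rightarrow>\<^sup>*\<^bsub>mk_symmetric H'\<^esub> v" for v
    proof -
      interpret W: wf_digraph H' using H'(1) by (simp add: subgraph_def)
      interpret S': pair_wf_digraph "mk_symmetric H'" by (rule W.wellformed_mk_symmetric)
      show ?thesis using that
      proof (induction rule: S'.reachable_induct)
        case base then show ?case using r by simp
      next
        case (step x y)
        then have "x \<rightarrow>\<^bsub>G\<^esub> y \<or> y \<rightarrow>\<^bsub>G\<^esub> x"
          using H'(2) by (auto simp: parcs_mk_symmetric subgraph_def compatible_def arcs_ends_conv)
        moreover have "y \<in> verts G"
          using step(2) S'.in_arcsD2 H'(2) by (auto simp: subgraph_def)
        ultimately show ?case using step(3) l by (auto simp: links_def)
      qed
    qed
    have "K \<subseteq> verts H'" using H'(1) by (auto simp: subgraph_def)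
    then have "verts H' = K"
      using H'(3) r stay unfolding connected_def strongly_connected_def by auto
    moreover from this have "arcs H' = arcs (G \<restriction> K)"
      using H'(1,2) by (auto simp: subgraph_def wf_digraph_def compatible_def)
    moreover have "tail H' = tail G" "head H' = head G"
      using H'(2) by (simp_all add: subgraph_def compatible_def)
    ultimately show ?thesis by (intro pre_digraph.equality) simp_all
  qed
  ultimately show ?thesis unfolding components_def max_subgraph_def by blast
qed

lemma paley_part_iso:
  assumes K: "K \<in> paley_parts (arcs_ends G) (verts G)"
  shows "\<exists>H. paley_family H \<and> digraph_iso (G \<restriction> K) (with_proj H)"
proof -
  have p: "paley_set (arcs_ends G) K" using K by (simp add: paley_parts_def)
  obtain g :: "'a \<Rightarrow> nat" where g: "inj_on g K"
    using finite_imp_inj_to_nat_seg[OF paley_set_finite[OF p]] by blast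
  have "wf_digraph (G \<restriction> K)" by (rule wellformed_induce_subgraph)
  moreover from this have "nomulti_digraph (G \<restriction> K)"
    using no_multi_arcs by (intro nomulti_digraph.intro nomulti_digraph_axioms.intro) (auto simp: arc_to_ends_def)
  ultimately have "digraph_iso (G \<restriction> K) (with_proj (relabel g (arcs_ends G) (verts (G \<restriction> K))))"
    using g by (intro digraph_iso_relabel) (simp_all add: arcs_ends_induce)
  then show ?thesis using paley_family_relabel[OF p g] by auto
qed

text \<open>Passing to the induced subgraph is injective, as its vertex set recovers the part. There
  are finitely many components because a subgraph shares \<open>tail\<close> and \<open>head\<close>
  with \<open>G\<close> and is fixed by its vertices and arcs.\<close>

lemma card_paley_parts_le: "card (paley_parts (arcs_ends G) (verts G)) \<le> paley_components G"
proof -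
  let ?C = "{C \<in> components G. \<exists>H. paley_family H \<and> digraph_iso C (with_proj H)}"
  have "components G \<subseteq> (\<lambda>(W, A). \<lparr>verts = W, arcs = A, tail = tail G, head = head G\<rparr>) ` (Pow (verts G) \<times> Pow (arcs G))"
  proof
    fix C assume "C \<in> components G"
    then have "subgraph C G" by (simp add: components_def max_subgraph_def)
    then have "C = (\<lambda>(W, A). \<lparr>verts = W, arcs = A, tail = tail G, head = head G\<rparr>) (verts C, arcs C)"
      "(verts C, arcs C) \<in> Pow (verts G) \<times> Pow (arcs G)"
      by (auto simp: subgraph_def compatible_def)
    then show "C \<in> (\<lambda>(W, A). \<lparr>verts = W, arcs = A, tail = tail G, head = head G\<rparr>) ` (Pow (verts G) \<times> Pow (arcs G))"
      by (rule image_eqI)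
  qed
  then have "finite (components G)" by (rule finite_subset) simp
  then have fin: "finite ?C" by simp
  have inj: "inj_on (\<lambda>K. G \<restriction> K) (paley_parts (arcs_ends G) (verts G))"
    by (rule inj_onI) (metis induce_subgraph_verts)
  have sub: "(\<lambda>K. G \<restriction> K) ` paley_parts (arcs_ends G) (verts G) \<subseteq> ?C"
    using paley_part_component paley_part_iso by blast
  show ?thesis unfolding paley_components_def by (rule card_inj_on_le[OF inj sub fin])
qed

end

theorem theorem8:
  fixes G :: "('a,'b) pre_digraph"
  assumes "oriented_graph G"
  shows "real (max_acyclic G) \<ge>
    (7 * real (card (verts G)) - real (card (arcs G)) - real (paley_components G)) / 9"
proof -
  interpret oriented_graph G by (rule assms)
  have "bound (arcs_ends G) (verts G)" by (rule bound_holds[OF finite_verts arcs_ends_asym])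
  then obtain S where S: "S \<subseteq> verts G" "acyc (arcs_ends G) S"
    "7 * card (verts G) \<le> 9 * card S + card (Restr (arcs_ends G) (verts G)) +
       card (paley_parts (arcs_ends G) (verts G))"
    unfolding bound_def by blast
  have "card (Restr (arcs_ends G) (verts G)) \<le> card (arcs_ends G)"
    by (intro card_mono) (auto simp: arcs_ends_conv)
  also have "\<dots> \<le> card (arcs G)" unfolding arcs_ends_def by (rule card_image_le) simp
  finally have "7 * card (verts G) \<le> 9 * max_acyclic G + card (arcs G) + paley_components G"
    using S(3) card_le_max_acyclic[OF acyclic_set_if_acyc[OF S(1,2)]] card_paley_parts_le by linarith
  then have "7 * real (card (verts G)) \<le> 9 * real (max_acyclic G) + real (card (arcs G)) + real (paley_components G)"
    by linarith
  then show ?thesis by simp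
qed

end
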